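(* Let $\beta\in(-\infty,0)\cup(0,1]$, $G_\beta(u)=\frac{\beta}{|\beta|}u^\beta$, $L\in\mathbb{N}$, $d>0$, and $u_0\in\mathcal{P}_{L,d}$. Then there exists a solution $u$ on $[0,\infty)$ of $\partial_tu=\Delta G_\beta(u)$, $u(0)=u_0$, and a constant $c=c(L,d,\beta,\|u_0\|_\infty)>0$ such that: 1. if $\beta\in(-\infty,0)\cup(0,1)$, then $u(t,k)\ge c\,(1\wedge t^{\frac1{1-\beta}})$ for all $t\ge0$, $k\in\mathbb{Z}$; 2. if $\beta=1$, then $u(t,k)\ge c\,e^{-2t}I_L(2t)$ for all $t\ge0$, $k\in\mathbb{Z}$; 3. (comparison principle) if $c_1\le u_0\le c_2$, then $c_1\le u(t,\cdot)\le c_2$ for all $t\ge0$.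
   Context: $\Delta v(k)=v(k-1)-2v(k)+v(k+1)$. For $u\in\ell^\infty_+(\mathbb{Z})$ and $d>0$ let $\sigma_+(u,k,d)=\inf\{l>k:u(l)\ge d\}$, and $\mathcal{P}_{L,d}=\{u\in\ell^\infty_+(\mathbb{Z}):\sup_{k\in\mathbb{Z}}(\sigma_+(u,k,d)-k)\le L\}$. A solution is a map $u:[0,\infty)\to\ell^\infty_+(\mathbb{Z})$ with $u\in C^0([0,\infty);\ell^\infty_+(\mathbb{Z}))$, $u(0)=u_0$, and for every $k$, $u(\cdot,k)\in C^1((0,\infty);(0,\infty))$ with $\frac{d}{dt}u(t,k)=\Delta G_\beta(u)(t,k)$ for all $t>0$. $I_L$ is the modified Bessel function of the first kind of order $L$, $I_L(s)=\frac1\pi\int_0^\pi e^{s\cos\theta}\cos(L\theta)\,d\theta$. *)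

theory Defs
  imports "HOL-Analysis.Analysis"
begin

type_synonym seq = "int \<Rightarrow> real"

definition dlap :: "seq \<Rightarrow> seq" where
  "dlap v k = v (k - 1) - 2 * v k + v (k + 1)"

definition Gb :: "real \<Rightarrow> real \<Rightarrow> real" where
  "Gb \<beta> x = (\<beta> / \<bar>\<beta>\<bar>) * x powr \<beta>"

definition linf_plus :: "seq set" where
  "linf_plus = {u. bounded (range u) \<and> (\<forall>k. 0 \<le> u k)}"

definition sup_norm :: "seq \<Rightarrow> real" where
  "sup_norm u = (SUP k. \<bar>u k\<bar>)"

text \<open>sigma_+(u,k,d) = inf {l > k : u(l) >= d}, in extended reals (inf of empty set = +infinity).\<close>
definition sigma_plus :: "seq \<Rightarrow> int \<Rightarrow> real \<Rightarrow> ereal" where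
  "sigma_plus u k d = Inf ((\<lambda>l. ereal (real_of_int l)) ` {l. k < l \<and> d \<le> u l})"

definition P_class :: "nat \<Rightarrow> real \<Rightarrow> seq set" where
  "P_class L d = {u \<in> linf_plus.
      (SUP k. sigma_plus u k d - ereal (real_of_int k)) \<le> ereal (real L)}"

definition is_solution :: "real \<Rightarrow> seq \<Rightarrow> (real \<Rightarrow> seq) \<Rightarrow> bool" where
  "is_solution \<beta> u0 u \<longleftrightarrow>
     (\<forall>t\<ge>0. u t \<in> linf_plus) \<and>
     (\<forall>t0\<ge>0. \<forall>\<epsilon>>0. \<exists>\<delta>>0. \<forall>t\<ge>0. \<bar>t - t0\<bar> < \<delta> \<longrightarrow>
         (\<forall>k. \<bar>u t k - u t0 k\<bar> \<le> \<epsilon>)) \<and>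
     u 0 = u0 \<and>
     (\<forall>k. (\<forall>t>0. 0 < u t k) \<and>
          (\<forall>t>0. ((\<lambda>s. u s k) has_real_derivative dlap (\<lambda>j. Gb \<beta> (u t j)) k) (at t)) \<and>
          continuous_on {0<..} (\<lambda>t. dlap (\<lambda>j. Gb \<beta> (u t j)) k))"

definition besselI :: "nat \<Rightarrow> real \<Rightarrow> real" where
  "besselI L s = (1 / pi) * integral {0..pi} (\<lambda>\<theta>. exp (s * cos \<theta>) * cos (real L * \<theta>))"

end

(* For beta < 1 and a = 1 / (1 - beta), both sides of the equation scale like t^(a - 1) on a separated
   profile t^a * f(k). Between two sites where u0 >= d one can thus put a
   subsolution c * t^a * f, where Gb beta f is a parabola in the distance to the next site, while
   the sites themselves lose mass so slowly that they keep at least d / 2 for a short time. This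
   gives u >= c * min 1 t^a for the solutions with data u0 + e, uniformly in e > 0. These solutions
   stay above e, where Gb beta is Lipschitz, so they exist and obey comparison; they decrease as
   e -> 0, and the lower bound controls the singular flux well enough to pass to the limit.
   For beta = 1 the solution is compared with d times the heat kernel e^(-2t) I_k(2t) centred at
   the next site where u0 >= d; the kernel is decreasing in |k|. *)

theory Submission
  imports Defs
begin

section \<open>Maximum principle on an infinite lattice\<close>

text \<open>For \<beta> < 1 the nonlinearity is not Lipschitz at 0, where the data may vanish, and
  for \<beta> < 0 the flux even blows up there. Moreover, on an infinite lattice extrema need not be
  attained, so comparison has to be quantitative and restricted to bounded families. The exponent is
  forced by the balance a - 1 = a \<beta>. It also makes the limit possible: for \<beta> < 0 the
  lower bound dominates the flux by a multiple of 1 + t^(a - 1), which is integrable at 0 because a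
  > 0. Time increments are then controlled down to t = 0 by one function of time, the same for all k
  and e, and this gives the continuity in the sup norm that a solution must have. Monotonicity in e
  yields pointwise limits without a compactness argument. Between sites the flux is prescribed
  rather than the profile: the Laplacian acts on the flux, so a parabola turns the spatial side into
  a constant times a power of t.\<close>

text \<open>The times with \<open>g \<ge> 0\<close> form a nonempty compact set, and
  \<open>s\<close> is its maximum.\<close>

lemma last_nonneg_time:
  fixes g :: "real \<Rightarrow> real"
  assumes "continuous_on {a..t} g" "0 \<le> g a" "g t < 0" "a \<le> t"
  obtains s where "a \<le> s" "s < t" "0 \<le> g s" "\<And>x. s < x \<Longrightarrow> x \<le> t \<Longrightarrow> g x < 0"
proof -
  let ?S = "{a..t} \<inter> g -` {0..}"
  have "compact ?S"
    using continuous_closed_preimage[OF assms(1), of "{0..}"] compact_Int_closed[of "{a..t}" ?S] by auto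
  moreover have "?S \<noteq> {}" using assms by auto
  ultimately obtain s where s: "s \<in> ?S" "\<forall>x\<in>?S. x \<le> s"
    using compact_attains_sup by blast
  show thesis
  proof
    show "s < t" using s assms by (cases "s = t") auto
    show "g x < 0" if "s < x" "x \<le> t" for x
      using bspec[OF s(2), of x] s(1) that by (auto simp: not_le[symmetric])
  qed (use s in auto)
qed

text \<open>If \<open>w \<ge> - N\<close> on an interval shorter than \<open>1 / (2 C)\<close>, then the differential inequality,
  integrated from the last time at which \<open>w \<ge> 0\<close>, improves the bound to \<open>w \<ge> - N / 2\<close>.
  Iterating replaces the usual maximum at a point, which need not be attained on an infinite set.\<close>

lemma maximum_principle_short_time:
  fixes w w' :: "real \<Rightarrow> 'i \<Rightarrow> real"
  assumes cont: "\<And>k. continuous_on {a..b} (\<lambda>t. w t k)"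
    and der: "\<And>k t. a < t \<Longrightarrow> t < b \<Longrightarrow> ((\<lambda>s. w s k) has_real_derivative w' t k) (at t)"
    and bdd: "\<And>k t. a \<le> t \<Longrightarrow> t \<le> b \<Longrightarrow> - B \<le> w t k"
    and init: "\<And>k. 0 \<le> w a k"
    and C: "0 \<le> C" "C * (b - a) \<le> 1 / 2"
    and low: "\<And>N t k. \<lbrakk>a < t; t < b; 0 \<le> N; \<And>j. - N \<le> w t j; w t k < 0\<rbrakk> \<Longrightarrow> - C * N \<le> w' t k"
    and t: "a \<le> t" "t \<le> b"
  shows "0 \<le> w t k"
proof -
  define B' where "B' = max B 0"
  have "\<forall>t k. a \<le> t \<longrightarrow> t \<le> b \<longrightarrow> - (B' / 2 ^ n) \<le> w t k" for n
  proof (induction n)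
    case 0
    have "- B' \<le> - B" by (simp add: B'_def)
    then show ?case using order_trans[OF _ bdd] by auto
  next
    case (Suc n)
    define N where "N = B' / 2 ^ n"
    have N: "0 \<le> N" by (simp add: N_def B'_def)
    have IH: "- N \<le> w t k" if "a \<le> t" "t \<le> b" for t k
      using Suc that by (simp add: N_def)
    have "- (N / 2) \<le> w t k" if t: "a \<le> t" "t \<le> b" for t k
    proof (cases "w t k < 0")
      case True
      have ct: "continuous_on {a..t} (\<lambda>t. w t k)"
        using continuous_on_subset[OF cont] t by auto
      obtain s where s: "a \<le> s" "s < t" "0 \<le> w s k" "\<And>x. s < x \<Longrightarrow> x \<le> t \<Longrightarrow> w x k < 0"
        using last_nonneg_time[OF ct init True t(1)] by metis
      have "(\<lambda>t. w t k) differentiable (at x)" if "s < x" "x < t" for x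
        using der[of x k] s t that by (auto simp: real_differentiable_def)
      then have "\<exists>l z. s < z \<and> z < t \<and> ((\<lambda>t. w t k) has_real_derivative l) (at z) \<and> w t k - w s k = (t - s) * l"
        using s t by (intro MVT continuous_on_subset[OF ct]) auto
      then obtain l z where z: "s < z" "z < t" "((\<lambda>t. w t k) has_real_derivative l) (at z)"
        "w t k - w s k = (t - s) * l" by blast
      have "l = w' z k" using DERIV_unique[OF z(3) der[of z k]] s t z by simp
      moreover have "- C * N \<le> w' z k"
        by (rule low) (use IH N s z(1,2) t in auto)
      ultimately have "(t - s) * (- C * N) \<le> (t - s) * l"
        using s by (intro mult_left_mono) auto
      moreover have "(t - s) * (C * N) \<le> (b - a) * (C * N)"
        using s t N C by (intro mult_right_mono) auto
      moreover have "(b - a) * (C * N) \<le> 1 / 2 * N"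
        using mult_right_mono[OF C(2) N] by (simp add: algebra_simps)
      ultimately show ?thesis using s z(4) by (simp add: algebra_simps)
    qed (use N in auto)
    then show ?case by (simp add: N_def mult.commute)
  qed
  then have "\<And>n. - (B' / 2 ^ n) \<le> w t k" using t by auto
  moreover have "(\<lambda>n. - (B' / 2 ^ n)) \<longlonglongrightarrow> - 0"
    by (intro tendsto_minus) (rule LIMSEQ_divide_realpow_zero, simp)
  ultimately show ?thesis
    using LIMSEQ_le_const2 by (metis minus_zero)
qed

text \<open>The admissible step \<open>h\<close> depends on \<open>C\<close> alone, neither on
  \<open>B\<close> nor on the progress made, so finitely many restarts of the short-time statement
  reach every time.\<close>

lemma maximum_principle:
  fixes w w' :: "real \<Rightarrow> 'i \<Rightarrow> real"
  assumes cont: "\<And>k. continuous_on {a..b} (\<lambda>t. w t k)"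
    and der: "\<And>k t. a < t \<Longrightarrow> t < b \<Longrightarrow> ((\<lambda>s. w s k) has_real_derivative w' t k) (at t)"
    and bdd: "\<And>k t. a \<le> t \<Longrightarrow> t \<le> b \<Longrightarrow> - B \<le> w t k"
    and init: "\<And>k. 0 \<le> w a k"
    and C: "0 \<le> C"
    and low: "\<And>N t k. \<lbrakk>a < t; t < b; 0 \<le> N; \<And>j. - N \<le> w t j; w t k < 0\<rbrakk> \<Longrightarrow> - C * N \<le> w' t k"
    and t: "a \<le> t" "t \<le> b"
  shows "0 \<le> w t k"
proof -
  define h where "h = 1 / (2 * (C + 1))"
  have h: "0 < h" "C * h \<le> 1 / 2" using C by (auto simp: h_def field_simps)
  have "\<forall>t k. a \<le> t \<longrightarrow> t \<le> min b (a + n * h) \<longrightarrow> 0 \<le> w t k" for n :: nat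
  proof (induction n)
    case 0
    then show ?case using init by (metis add.right_neutral antisym min.boundedE mult_zero_left of_nat_0)
  next
    case (Suc n)
    define a' where "a' = a + n * h"
    define b' where "b' = min b (a + Suc n * h)"
    have aa: "a \<le> a'" and bb: "b' \<le> b" using h by (auto simp: a'_def b'_def)
    have "b' - a' \<le> h" by (auto simp: a'_def b'_def algebra_simps min_def)
    then have "C * (b' - a') \<le> C * h" using C by (intro mult_left_mono)
    then have Ch: "C * (b' - a') \<le> 1 / 2" using h by simp
    have "0 \<le> w t k" if t: "a \<le> t" "t \<le> b'" for t k
    proof (cases "t \<le> a'")
      case True
      then show ?thesis using Suc t bb by (auto simp: a'_def)
    next
      case False
      have "a' \<le> b" using False t bb by auto
      then have i: "0 \<le> w a' k" for k using Suc aa by (auto simp: a'_def)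
      show ?thesis
      proof (rule maximum_principle_short_time[where a = a' and b = b' and w' = w' and B = B and C = C and w = w])
        show "continuous_on {a'..b'} (\<lambda>t. w t k)" for k
          using continuous_on_subset[OF cont] aa bb by auto
      qed (use der bdd i C Ch low aa bb t False in auto)
    qed
    then show ?case by (simp add: b'_def)
  qed
  moreover obtain n :: nat where "(t - a) / h \<le> n" using real_arch_simple by blast
  then have "t \<le> a + n * h" using h by (simp add: field_simps)
  ultimately show ?thesis using t by auto
qed

section \<open>Flows with a Lipschitz nonlinearity\<close>

text \<open>The bound uniform in \<open>k\<close> on bounded time intervals is what starts the
  iteration in the maximum principle; the equation is imposed for \<open>t > 0\<close> only, and
  continuity links it to the initial value.\<close>

definition flow :: "(real \<Rightarrow> real) \<Rightarrow> (real \<Rightarrow> seq) \<Rightarrow> bool" where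
  "flow F u \<longleftrightarrow>
     (\<forall>k. continuous_on {0..} (\<lambda>t. u t k)) \<and>
     (\<forall>t>0. \<forall>k. ((\<lambda>s. u s k) has_real_derivative dlap (\<lambda>j. F (u t j)) k) (at t)) \<and>
     (\<forall>T. \<exists>B. \<forall>t\<in>{0..T}. \<forall>k. \<bar>u t k\<bar> \<le> B)"

section \<open>Tools for the Picard map and global existence\<close>

lemma continuous_on_indefinite_integral:
  fixes g :: "real \<Rightarrow> real"
  assumes "continuous_on UNIV g"
  shows "continuous_on {0..} (\<lambda>t. integral {0..t} g)"
  unfolding continuous_on_eq_continuous_within
proof
  fix t :: real assume t: "t \<in> {0..}"
  have "g integrable_on {0..t+1}"
    using continuous_on_subset[OF assms] by (intro integrable_continuous_real) auto
  then have "continuous_on {0..t+1} (\<lambda>t. integral {0..t} g)"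
    by (rule indefinite_integral_continuous_1)
  then have "continuous (at t within {0..t+1}) (\<lambda>t. integral {0..t} g)"
    using t by (auto simp: continuous_on_eq_continuous_within)
  moreover have "at t within {0..} = at t within {0..t+1}"
    by (rule at_within_nhd[of _ "{..<t+1}"]) auto
  ultimately show "continuous (at t within {0..}) (\<lambda>t. integral {0..t} g)" by simp
qed

lemma indefinite_integral_has_derivative:
  fixes g :: "real \<Rightarrow> real"
  assumes "continuous_on UNIV g" "0 < t"
  shows "((\<lambda>t. integral {0..t} g) has_real_derivative g t) (at t)"
proof -
  have "((\<lambda>t. integral {0..t} g) has_real_derivative g t) (at t within {0..t+1})"
    using assms continuous_on_subset[OF assms(1)] by (intro integral_has_real_derivative) auto
  then show ?thesis using assms at_within_Icc_at[of 0 t "t+1"] by simp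
qed

text \<open>Slices with fixed second coordinate are open, so continuity glues. A lattice-indexed
  family of functions of time thereby becomes one point of a Banach space of bounded continuous
  functions on \<open>real \<times> int\<close>.\<close>

lemma continuous_on_discrete_snd:
  fixes f :: "'a::topological_space \<Rightarrow> 'b::discrete_topology \<Rightarrow> 'c::topological_space"
  assumes "\<And>k. continuous_on UNIV (\<lambda>t. f t k)"
  shows "continuous_on UNIV (\<lambda>p. f (fst p) (snd p))"
proof -
  have "continuous_on (UNIV \<times> {k}) (\<lambda>p. f (fst p) (snd p))" for k
  proof -
    have "continuous_on (UNIV \<times> {k}) (\<lambda>p. f (fst p) k)"
      by (rule continuous_on_compose2[OF assms]) (auto intro: continuous_intros)
    then show ?thesis by (rule continuous_on_eq) auto
  qed
  then have "continuous_on (\<Union>k\<in>UNIV. UNIV \<times> {k}) (\<lambda>p. f (fst p) (snd p))"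
    by (intro continuous_on_open_UN open_Times) (auto simp: open_discrete)
  moreover have "(\<Union>k\<in>UNIV. UNIV \<times> {k}) = (UNIV :: ('a \<times> 'b) set)" by auto
  ultimately show ?thesis by simp
qed

lemma abs_dlap_le:
  assumes "\<And>j. \<bar>v j\<bar> \<le> N"
  shows "\<bar>dlap v k\<bar> \<le> 4 * N"
  using assms[of k] assms[of "k - 1"] assms[of "k + 1"] unfolding dlap_def by linarith

lemma integral_exp_scale:
  fixes c l t :: real
  assumes "0 < l" "0 \<le> t"
  shows "((\<lambda>s. c * exp (l * s)) has_integral c / l * (exp (l * t) - 1)) {0..t}"
proof -
  have "((\<lambda>s. c * exp (l * s)) has_integral c / l * exp (l * t) - c / l * exp (l * 0)) {0..t}"
    using assms by (intro fundamental_theorem_of_calculus)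
      (auto simp: has_real_derivative_iff_has_vector_derivative[symmetric] intro!: derivative_eq_intros)
  then show ?thesis by (simp add: algebra_simps)
qed

lemma lipschitz_imp_continuous_on:
  fixes F :: "real \<Rightarrow> real"
  assumes "\<And>x y. \<bar>F x - F y\<bar> \<le> K * \<bar>x - y\<bar>"
  shows "continuous_on S F"
proof -
  have "0 \<le> K" using order_trans[OF abs_ge_zero assms[of 1 0]] by simp
  then have "K-lipschitz_on S F" using assms by (auto simp: lipschitz_on_def dist_real_def)
  then show ?thesis by (rule lipschitz_on_continuous_on)
qed

text \<open>The library proves this only over a metric domain, which excludes \<^typ>\<open>int\<close>.\<close>

lemma complete_UNIV_bcontfun:
  "complete (UNIV :: ('a::topological_space \<Rightarrow>\<^sub>C 'b::complete_space) set)"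
  unfolding complete_def
proof (intro allI impI)
  fix f :: "nat \<Rightarrow> ('a \<Rightarrow>\<^sub>C 'b)"
  assume "(\<forall>n. f n \<in> UNIV) \<and> Cauchy f"
  then obtain g where "uniform_limit UNIV f g sequentially"
    using uniformly_convergent_eq_cauchy[of "\<lambda>_. True" f]
    unfolding Cauchy_def uniform_limit_sequentially_iff
    by (metis dist_fun_lt_imp_dist_val_lt)
  from uniform_limit_bcontfunE[OF this sequentially_bot]
  show "\<exists>l\<in>UNIV. f \<longlonglongrightarrow> l" by (metis UNIV_I)
qed

text \<open>In the weighted norm \<open>sup exp (- \<lambda> t) \<bar>u t k\<bar>\<close> with \<open>\<lambda>\<close> large the Picard map
  is a contraction on all of \<open>[0, \<infinity>)\<close>; below \<open>v = exp (- \<lambda> t) u\<close>.\<close>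

lemma flow_exists:
  assumes lip: "\<And>x y. \<bar>F x - F y\<bar> \<le> K * \<bar>x - y\<bar>" and F0: "F 0 = 0"
    and u0: "\<And>k. \<bar>u0 k\<bar> \<le> M"
  shows "\<exists>u. flow F u \<and> u 0 = u0"
proof -
  have K: "0 \<le> K" using order_trans[OF abs_ge_zero lip[of 1 0]] by simp
  \<comment> \<open>The Laplacian of \<open>F\<close> has Lipschitz constant \<open>4 * K\<close> in
    the sup norm and integrating the weight gains \<open>1 / l\<close>; the 8 makes the contraction
    factor at most 1/2, the 1 keeps \<open>l\<close> positive if \<open>K = 0\<close>.\<close>
  define l where "l = 8 * K + 1"
  have l: "0 < l" "4 * K / l \<le> 1 / 2" using K by (auto simp: l_def field_simps)
  define g where "g v k s = dlap (\<lambda>j. F (exp (l * s) * apply_bcontfun v (s, j))) k"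
    for v :: "(real \<times> int) \<Rightarrow>\<^sub>C real" and k s
  define I where "I v k t = integral {0..t} (g v k)" for v k t
  \<comment> \<open>\<open>max 0 t\<close> freezes the image at the initial value for negative
    times, so the whole real line can serve as the time domain.\<close>
  define P where "P v t k = exp (- l * max 0 t) * (u0 k + I v k (max 0 t))" for v t k
  have contg: "continuous_on S (g v k)" for v k S
  proof -
    have "continuous_on S (\<lambda>s. F (exp (l * s) * apply_bcontfun v (s, j)))" for j
      by (intro continuous_on_compose2[OF lipschitz_imp_continuous_on[OF lip, of UNIV]]
          continuous_on_compose2[OF continuous_on_apply_bcontfun[of UNIV v]] continuous_intros) auto
    then show ?thesis unfolding g_def dlap_def by (intro continuous_intros)
  qed
  have int_bound: "\<bar>I v k t - I w k t\<bar> \<le> exp (l * t) * (dist v w / 2)"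
    if "0 \<le> t" for v w k t
  proof -
    have gi: "g v k integrable_on {0..t}" for v
      by (intro integrable_continuous_real contg)
    have "\<bar>g v k s - g w k s\<bar> \<le> 4 * K * dist v w * exp (l * s)" for s
    proof -
      have "\<bar>F (exp (l * s) * v (s, j)) - F (exp (l * s) * w (s, j))\<bar>
        \<le> K * dist v w * exp (l * s)" for j
      proof -
        have "\<bar>exp (l * s) * v (s, j) - exp (l * s) * w (s, j)\<bar> = exp (l * s) * dist (v (s, j)) (w (s, j))"
          by (simp add: right_diff_distrib[symmetric] abs_mult dist_real_def)
        also have "\<dots> \<le> exp (l * s) * dist v w"
          by (intro mult_left_mono dist_bounded) auto
        finally have "K * \<bar>exp (l * s) * v (s, j) - exp (l * s) * w (s, j)\<bar> \<le> K * (exp (l * s) * dist v w)"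
          by (intro mult_left_mono K)
        from order_trans[OF lip this] show ?thesis by (simp only: mult_ac)
      qed
      then have "\<bar>dlap (\<lambda>j. F (exp (l * s) * v (s, j)) - F (exp (l * s) * w (s, j))) k\<bar> \<le> 4 * (K * dist v w * exp (l * s))"
        by (rule abs_dlap_le)
      moreover have "g v k s - g w k s = dlap (\<lambda>j. F (exp (l * s) * v (s, j)) - F (exp (l * s) * w (s, j))) k"
        unfolding g_def dlap_def by argo
      ultimately show ?thesis by (simp only: mult.assoc)
    qed
    then have "\<bar>integral {0..t} (\<lambda>s. g v k s - g w k s)\<bar> \<le> integral {0..t} (\<lambda>s. 4 * K * dist v w * exp (l * s))"
      using has_integral_integrable[OF integral_exp_scale[OF l(1) that]]
      by (intro integral_norm_bound_integral[where 'a = real, unfolded real_norm_def] integrable_diff gi) auto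
    also have "\<dots> = (4 * K / l) * (dist v w * (exp (l * t) - 1))"
      using integral_unique[OF integral_exp_scale[OF l(1) that]] by simp
    also have "\<dots> \<le> 1 / 2 * (dist v w * (exp (l * t) - 1))"
      using l that by (intro mult_right_mono) auto
    also have "\<dots> \<le> exp (l * t) * (dist v w / 2)"
      by (simp add: algebra_simps)
    finally show ?thesis using gi by (simp add: I_def integral_diff)
  qed
  have dist_P: "\<bar>P v t k - P w t k\<bar> \<le> dist v w / 2" for v w t k
  proof -
    have "\<bar>P v t k - P w t k\<bar> = exp (- l * max 0 t) * \<bar>I v k (max 0 t) - I w k (max 0 t)\<bar>"
      by (simp add: P_def right_diff_distrib[symmetric] abs_mult)
    also have "\<dots> \<le> exp (- l * max 0 t) * (exp (l * max 0 t) * (dist v w / 2))"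
      by (intro mult_left_mono int_bound) auto
    also have "\<dots> = dist v w / 2" by (simp add: exp_minus)
    finally show ?thesis .
  qed
  \<comment> \<open>As \<open>F 0 = 0\<close>, the zero function is mapped to the damped initial
    datum, which is bounded; by the contraction estimate all other images are bounded too.\<close>
  have "I 0 k t = 0" for k t
    by (simp add: I_def g_def[abs_def] dlap_def F0)
  then have P0: "\<bar>P 0 t k\<bar> \<le> M" for t k
    using mult_mono[of "exp (- l * max 0 t)" 1 "\<bar>u0 k\<bar>" M] u0[of k] l by (simp add: P_def abs_mult)
  have contI: "continuous_on {0..} (I v k)" for v k
    unfolding I_def[abs_def] by (intro continuous_on_indefinite_integral contg)
  have P_in: "(\<lambda>p. P v (fst p) (snd p)) \<in> bcontfun" for v
  proof -
    have "continuous_on UNIV (\<lambda>t. P v t k)" for k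
      unfolding P_def
      by (intro continuous_intros continuous_on_compose2[OF contI]) auto
    moreover have "\<bar>P v t k\<bar> \<le> M + dist v 0 / 2" for t k
      using dist_P[of v t k 0] P0[of t k] by linarith
    ultimately show ?thesis
      by (auto simp: bcontfun_def intro!: continuous_on_discrete_snd boundedI)
  qed
  define \<Phi> where "\<Phi> v = Bcontfun (\<lambda>p. P v (fst p) (snd p))" for v
  have \<Phi>: "apply_bcontfun (\<Phi> v) (t, k) = P v t k" for v t k
    by (simp add: \<Phi>_def Bcontfun_inverse[OF P_in])
  have "dist (\<Phi> v) (\<Phi> w) \<le> 1 / 2 * dist v w" for v w
    using dist_P by (intro dist_bound) (auto simp: \<Phi> dist_real_def)
  then obtain v where v: "\<Phi> v = v"
    using Banach_fix[OF complete_UNIV_bcontfun UNIV_not_empty, of "1 / 2" \<Phi>] by auto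
  define u where "u t k = exp (l * max 0 t) * apply_bcontfun v (t, k)" for t k
  have u: "u t k = u0 k + I v k (max 0 t)" for t k
    using \<Phi>[of v t k] by (simp add: v u_def P_def exp_minus)
  have g: "g v k t = dlap (\<lambda>j. F (u t j)) k" if "0 \<le> t" for k t
    using that by (simp add: g_def u_def)
  have "flow F u" unfolding flow_def
  proof (intro conjI allI impI)
    show "continuous_on {0..} (\<lambda>t. u t k)" for k
      unfolding u by (intro continuous_intros continuous_on_compose2[OF contI]) auto
    show "((\<lambda>s. u s k) has_real_derivative dlap (\<lambda>j. F (u t j)) k) (at t)" if "0 < t" for t k
    proof (rule DERIV_cong)
      show "((\<lambda>s. u s k) has_real_derivative 0 + g v k t) (at t)"
      proof (rule has_field_derivative_transform_within_open)
        show "((\<lambda>s. u0 k + I v k s) has_real_derivative 0 + g v k t) (at t)"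
          unfolding I_def
          by (intro DERIV_add DERIV_const indefinite_integral_has_derivative contg that)
        show "open {0::real<..}" "t \<in> {0<..}" using that by auto
      qed (simp add: u)
    qed (use g that in simp)
    fix T
    have "bounded (range (apply_bcontfun v))" by simp
    then obtain B where B: "\<And>p. \<bar>apply_bcontfun v p\<bar> \<le> B" by (auto simp: bounded_iff)
    have "\<bar>u t k\<bar> \<le> exp (l * T) * B" if "t \<in> {0..T}" for t k
      unfolding u_def abs_mult using that l B by (intro mult_mono) auto
    then show "\<exists>B. \<forall>t\<in>{0..T}. \<forall>k. \<bar>u t k\<bar> \<le> B" by blast
  qed
  moreover have "u 0 = u0" by (auto simp: u I_def)
  ultimately show ?thesis by blast
qed

section \<open>Comparison of sub- and supersolutions\<close>

text \<open>Where \<open>v\<close> exceeds \<open>u\<close>, the central term of the Laplacian helps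
  by monotonicity of \<open>F\<close>. Only the two neighbours can hurt, each by at most
  \<open>K * N\<close>, which gives the rate \<open>2 * K\<close>. The differential inequality is
  requested only where \<open>u < v\<close>, so that a truncated equation can be handled where its
  truncation is inactive.\<close>

lemma comparison_principle:
  fixes u v u' v' :: "real \<Rightarrow> seq"
  assumes mono: "mono F" and lip: "\<And>x y. \<bar>F x - F y\<bar> \<le> K * \<bar>x - y\<bar>"
    and cont: "\<And>k. continuous_on {a..b} (\<lambda>t. u t k)" "\<And>k. continuous_on {a..b} (\<lambda>t. v t k)"
    and der: "\<And>k t. a < t \<Longrightarrow> t < b \<Longrightarrow> ((\<lambda>s. u s k) has_real_derivative u' t k) (at t)"
      "\<And>k t. a < t \<Longrightarrow> t < b \<Longrightarrow> ((\<lambda>s. v s k) has_real_derivative v' t k) (at t)"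
    and bdd: "\<And>k t. a \<le> t \<Longrightarrow> t \<le> b \<Longrightarrow> v t k - u t k \<le> B"
    and init: "\<And>k. v a k \<le> u a k"
    and sub: "\<And>k t. \<lbrakk>a < t; t < b; u t k < v t k\<rbrakk> \<Longrightarrow>
      v' t k - u' t k \<le> dlap (\<lambda>j. F (v t j)) k - dlap (\<lambda>j. F (u t j)) k"
    and t: "a \<le> t" "t \<le> b"
  shows "v t k \<le> u t k"
proof -
  have K: "0 \<le> K" using order_trans[OF abs_ge_zero lip[of 1 0]] by simp
  have "0 \<le> u t k - v t k"
  proof (rule maximum_principle[where w = "\<lambda>t k. u t k - v t k" and w' = "\<lambda>t k. u' t k - v' t k"
        and a = a and b = b and C = "2 * K" and B = B])
    show "- (2 * K) * N \<le> u' t k - v' t k"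
      if "a < t" "t < b" "0 \<le> N" and N: "\<And>j. - N \<le> u t j - v t j" and neg: "u t k - v t k < 0"
      for N t k
    proof -
      have "F (v t j) - F (u t j) \<le> K * N" for j
      proof (cases "v t j \<le> u t j")
        case True
        then have "F (v t j) \<le> F (u t j)" using mono by (simp add: monoD)
        moreover have "0 \<le> K * N" using K that by simp
        ultimately show ?thesis by linarith
      next
        case False
        then have "K * \<bar>v t j - u t j\<bar> \<le> K * N"
          using N[of j] K by (intro mult_left_mono) auto
        then show ?thesis using lip[of "v t j" "u t j"] by linarith
      qed
      from this[of "k - 1"] this[of "k + 1"]
      have "dlap (\<lambda>j. F (v t j)) k - dlap (\<lambda>j. F (u t j)) k \<le> 2 * (K * N)"
        using monoD[OF mono, of "u t k" "v t k"] neg unfolding dlap_def by linarith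
      then show ?thesis using sub[of t k] that neg by simp
    qed
    show "- B \<le> u t k - v t k" if "a \<le> t" "t \<le> b" for t k
      using bdd[OF that, of k] by simp
  qed (use t init K in \<open>auto intro!: continuous_intros cont derivative_intros der\<close>)
  then show ?thesis by simp
qed

lemma flow_mono:
  assumes mono: "mono F" and lip: "\<And>x y. \<bar>F x - F y\<bar> \<le> K * \<bar>x - y\<bar>"
    and u: "flow F u" and v: "flow F v" and init: "\<And>k. v 0 k \<le> u 0 k" and t: "0 \<le> t"
  shows "v t k \<le> u t k"
proof -
  obtain Bu where Bu: "\<forall>s\<in>{0..t}. \<forall>k. \<bar>u s k\<bar> \<le> Bu" using u unfolding flow_def by blast
  obtain Bv where Bv: "\<forall>s\<in>{0..t}. \<forall>k. \<bar>v s k\<bar> \<le> Bv" using v unfolding flow_def by blast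
  have cu: "continuous_on {0..t} (\<lambda>s. u s k)" and cv: "continuous_on {0..t} (\<lambda>s. v s k)" for k
    using u v unfolding flow_def by (auto elim!: continuous_on_subset allE[of _ k])
  show ?thesis
  proof (rule comparison_principle[OF mono lip, where u = u and v = v and a = 0 and b = t and B = "Bu + Bv"
        and u' = "\<lambda>t. dlap (\<lambda>j. F (u t j))" and v' = "\<lambda>t. dlap (\<lambda>j. F (v t j))"])
    show "v s k - u s k \<le> Bu + Bv" if "0 \<le> s" "s \<le> t" for s k
      using Bu[THEN bspec, of s] Bv[THEN bspec, of s] that
      by (auto simp: abs_le_iff dest!: spec[of _ k])
  qed (use u v init t cu cv in \<open>auto simp: flow_def\<close>)
qed

lemma flow_const: "flow F (\<lambda>t k. c)"
  by (auto simp: flow_def dlap_def)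

section \<open>The nonlinearity and its truncation at level e\<close>

lemma Gb_has_derivative:
  assumes "\<beta> \<noteq> 0" "0 < x"
  shows "(Gb \<beta> has_real_derivative \<bar>\<beta>\<bar> * x powr (\<beta> - 1)) (at x)"
  unfolding Gb_def[abs_def] using assms
  by (auto intro!: derivative_eq_intros simp: abs_if field_simps powr_diff)

text \<open>By the mean value theorem: the derivative is positive and, as
  \<open>\<beta> \<le> 1\<close>, nonincreasing, so its value at \<open>e\<close> is a Lipschitz
  constant on all of \<open>[e, \<infinity>)\<close>. For \<beta> < 1 this constant blows up as
  \<open>e\<close> tends to 0.\<close>

lemma Gb_diff_bounds:
  assumes b: "\<beta> \<noteq> 0" "\<beta> \<le> 1" and x: "0 < e" "e \<le> x" "x \<le> y"
  shows "0 \<le> Gb \<beta> y - Gb \<beta> x" "Gb \<beta> y - Gb \<beta> x \<le> \<bar>\<beta>\<bar> * e powr (\<beta> - 1) * (y - x)"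
proof -
  have "0 \<le> Gb \<beta> y - Gb \<beta> x \<and> Gb \<beta> y - Gb \<beta> x \<le> \<bar>\<beta>\<bar> * e powr (\<beta> - 1) * (y - x)"
  proof (cases "x = y")
    case False
    then have "x < y" using x by simp
    then obtain z where z: "x < z" "z < y"
      "Gb \<beta> y - Gb \<beta> x = (y - x) * (\<bar>\<beta>\<bar> * z powr (\<beta> - 1))"
      using MVT2[of x y "Gb \<beta>" "\<lambda>z. \<bar>\<beta>\<bar> * z powr (\<beta> - 1)"] Gb_has_derivative b x by force
    have "z powr (\<beta> - 1) \<le> e powr (\<beta> - 1)"
      using z x b by (intro powr_mono2') auto
    then have "(y - x) * (\<bar>\<beta>\<bar> * z powr (\<beta> - 1)) \<le> (y - x) * (\<bar>\<beta>\<bar> * e powr (\<beta> - 1))"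
      using x by (intro mult_left_mono) auto
    then show ?thesis using z x by (simp add: mult_ac)
  qed auto
  then show "0 \<le> Gb \<beta> y - Gb \<beta> x" "Gb \<beta> y - Gb \<beta> x \<le> \<bar>\<beta>\<bar> * e powr (\<beta> - 1) * (y - x)"
    by auto
qed

lemma Gb_mono:
  assumes "\<beta> \<noteq> 0" "\<beta> \<le> 1" "0 < x" "x \<le> y"
  shows "Gb \<beta> x \<le> Gb \<beta> y"
  using Gb_diff_bounds(1)[of \<beta> x x y] assms by simp

text \<open>Differs from \<open>Gb \<beta>\<close> on \<open>[e, \<infinity>)\<close> only by a constant, which the discrete Laplacian does not
  see; the constant makes the function vanish at 0, as \<open>flow_exists\<close> requires.\<close>

definition Gb_cut :: "real \<Rightarrow> real \<Rightarrow> real \<Rightarrow> real" where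
  "Gb_cut \<beta> e x = Gb \<beta> (max e x) - Gb \<beta> e"

lemma mono_Gb_cut:
  assumes "\<beta> \<noteq> 0" "\<beta> \<le> 1" "0 < e"
  shows "mono (Gb_cut \<beta> e)"
  unfolding Gb_cut_def using assms by (intro monoI diff_right_mono Gb_mono) auto

lemma Gb_cut_lipschitz:
  assumes "\<beta> \<noteq> 0" "\<beta> \<le> 1" "0 < e"
  shows "\<bar>Gb_cut \<beta> e x - Gb_cut \<beta> e y\<bar> \<le> \<bar>\<beta>\<bar> * e powr (\<beta> - 1) * \<bar>x - y\<bar>"
proof -
  have *: "\<bar>Gb_cut \<beta> e x - Gb_cut \<beta> e y\<bar> \<le> \<bar>\<beta>\<bar> * e powr (\<beta> - 1) * \<bar>x - y\<bar>" if "x \<le> y" for x y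
  proof -
    have "\<bar>\<beta>\<bar> * e powr (\<beta> - 1) * (max e y - max e x) \<le> \<bar>\<beta>\<bar> * e powr (\<beta> - 1) * \<bar>x - y\<bar>"
      using that by (intro mult_left_mono) auto
    then show ?thesis
      using Gb_diff_bounds[OF assms max.cobounded1[of e x] max.mono[OF order_refl that]] that by (simp add: Gb_cut_def)
  qed
  show ?thesis
  proof (cases "x \<le> y")
    case False
    then show ?thesis using *[of y x] by (simp only: abs_minus_commute[of x] abs_minus_commute[of "Gb_cut \<beta> e x"])
  qed (rule *)
qed

lemma dlap_Gb_cut:
  assumes "\<And>j. e \<le> v j"
  shows "dlap (\<lambda>j. Gb_cut \<beta> e (v j)) k = dlap (\<lambda>j. Gb \<beta> (v j)) k"
proof -
  have "max e (v j) = v j" for j using assms by (simp add: max_absorb2)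
  then show ?thesis by (simp add: dlap_def Gb_cut_def)
qed

section \<open>The self-similar subsolution\<close>

text \<open>If no site lay in the window, every candidate would be at least
  \<open>k + L + 1\<close>, a full unit above the allowed infimum. An empty set of candidates is
  covered, since its infimum is infinite.\<close>

lemma P_class_site:
  assumes "u0 \<in> P_class L d"
  shows "\<exists>l. k < l \<and> l \<le> k + int L \<and> d \<le> u0 l"
proof (rule ccontr)
  assume no: "\<not> ?thesis"
  have "sigma_plus u0 k d - ereal (real_of_int k) \<le> (SUP k. sigma_plus u0 k d - ereal (real_of_int k))"
    by (intro SUP_upper) auto
  also have "\<dots> \<le> ereal (real L)" using assms by (simp add: P_class_def)
  finally have "sigma_plus u0 k d \<le> ereal (real L + real_of_int k)"
    by (simp add: ereal_minus_le)
  moreover have "ereal (real L + real_of_int k + 1) \<le> sigma_plus u0 k d"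
    unfolding sigma_plus_def
  proof (rule INF_greatest)
    fix l assume "l \<in> {l. k < l \<and> d \<le> u0 l}"
    then have "\<not> l \<le> k + int L" using no by blast
    then have "k + int L + 1 \<le> l" by simp
    then have "real_of_int (k + int L + 1) \<le> real_of_int l" by (simp only: of_int_le_iff)
    then show "ereal (real L + real_of_int k + 1) \<le> ereal (real_of_int l)" by simp
  qed
  ultimately have "ereal (real L + real_of_int k + 1) \<le> ereal (real L + real_of_int k)"
    by (rule order_trans[rotated])
  then show False by simp
qed

lemma Gb_mult: "0 \<le> x \<Longrightarrow> 0 \<le> y \<Longrightarrow> Gb \<beta> (x * y) = x powr \<beta> * Gb \<beta> y"
  by (simp add: Gb_def powr_mult)

lemma powr_eventually_small:
  fixes p x :: real
  assumes "0 < p" "0 < x"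
  shows "\<exists>\<tau>>0. \<forall>t. 0 \<le> t \<and> t \<le> \<tau> \<longrightarrow> t powr p \<le> x"
proof (intro exI conjI allI impI)
  show "0 < x powr (1 / p)" using assms by simp
  fix t assume "0 \<le> t \<and> t \<le> x powr (1 / p)"
  then have "t powr p \<le> (x powr (1 / p)) powr p" using assms by (intro powr_mono2) auto
  then show "t powr p \<le> x" using assms by (simp add: powr_powr)
qed

text \<open>The flux \<open>Gb \<beta> (\<phi> n)\<close>, as a function of the distance \<open>n\<close> to the next site, is a
  parabola with second difference 2, decreasing on the gap and shifted so as to have the sign
  of \<open>\<beta>\<close>.\<close>

lemma gap_profile:
  assumes "\<beta> \<noteq> 0" "1 \<le> L"
  obtains \<phi> \<gamma> :: "nat \<Rightarrow> real" where
    "\<And>n. n \<le> L \<Longrightarrow> 0 < \<phi> n" "\<And>n. n \<le> L \<Longrightarrow> Gb \<beta> (\<phi> n) = \<gamma> n"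
    "\<And>n. n \<le> L \<Longrightarrow> \<phi> L \<le> \<phi> n" "\<And>n. n \<le> L \<Longrightarrow> \<phi> n \<le> \<phi> 0"
    "\<And>n. \<gamma> n - 2 * \<gamma> (Suc n) + \<gamma> (Suc (Suc n)) = 2"
    "\<And>n. n \<le> Suc L \<Longrightarrow> \<gamma> n \<le> \<gamma> 0"
proof
  \<comment> \<open>The square is at most \<open>4 * L^2\<close> for \<open>n \<le> L\<close>, so
    the negative shift makes the parabola negative there. The vertex \<open>2 * L\<close> lies at or
    beyond \<open>L + 1\<close>, hence the parabola still decreases one step past the longest
    gap.\<close>
  define A where "A = (if 0 < \<beta> then 1 else - (4 * real L ^ 2 + 1))"
  define \<gamma> where "\<gamma> n = (2 * real L - real n) ^ 2 + A" for n
  define \<phi> where "\<phi> n = \<bar>\<gamma> n\<bar> powr (1 / \<beta>)" for n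
  have dec: "\<gamma> n \<le> \<gamma> m" if "m \<le> n" "n \<le> 2 * L" for m n
    using that by (auto simp: \<gamma>_def intro!: power_mono)
  have pos: "0 < \<gamma> n" if "0 < \<beta>" for n
    using that by (simp add: \<gamma>_def A_def add_nonneg_pos)
  have neg: "\<gamma> n < 0" if "\<beta> < 0" "n \<le> L" for n
    using dec[of 0 n] that by (simp add: \<gamma>_def A_def power_mult_distrib)
  show "0 < \<phi> n" if "n \<le> L" for n
    using pos[of n] neg[of n] that assms by (cases "0 < \<beta>") (auto simp: \<phi>_def)
  show "Gb \<beta> (\<phi> n) = \<gamma> n" if "n \<le> L" for n
    using pos[of n] neg[of n] that assms
    by (cases "0 < \<beta>") (auto simp: \<phi>_def Gb_def powr_powr abs_if)
  \<comment> \<open>For \<beta> < 0 two reversals cancel: \<open>\<bar>\<gamma> n\<bar>\<close>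
    increases with \<open>n\<close>, and the exponent \<open>1 / \<beta>\<close> is
    negative.\<close>
  have anti: "\<phi> n \<le> \<phi> m" if "m \<le> n" "n \<le> L" for m n
  proof (cases "0 < \<beta>")
    case True
    then show ?thesis using dec[of m n] pos[of m] pos[of n] that
      by (auto simp: \<phi>_def intro!: powr_mono2)
  next
    case False
    then have "\<beta> < 0" using assms by simp
    then show ?thesis using dec[of m n] neg[of m] neg[of n] that
      by (auto simp: \<phi>_def intro!: powr_mono2')
  qed
  show "\<phi> L \<le> \<phi> n" if "n \<le> L" for n using anti that by simp
  show "\<phi> n \<le> \<phi> 0" if "n \<le> L" for n using anti that by simp
  show "\<gamma> n - 2 * \<gamma> (Suc n) + \<gamma> (Suc (Suc n)) = 2" for n
    by (simp add: \<gamma>_def power2_eq_square algebra_simps)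
  show "\<gamma> n \<le> \<gamma> 0" if "n \<le> Suc L" for n
    using dec[of 0 n] that assms by simp
qed

text \<open>Looks to the right only, because \<open>P_class\<close> guarantees sites there; counting
  from 0 makes the sites themselves the zeros.\<close>

definition gap :: "int set \<Rightarrow> int \<Rightarrow> nat" where
  "gap S k = (LEAST n. k + int n \<in> S)"

lemma gap_props:
  assumes S: "\<And>k. \<exists>l\<in>S. k < l \<and> l \<le> k + int L"
  shows "gap S k \<le> L" "gap S k = 0 \<longleftrightarrow> k \<in> S" "k \<notin> S \<Longrightarrow> gap S k = Suc (gap S (k + 1))"
proof -
  have ex: "\<exists>n. n \<le> L \<and> k + int n \<in> S" for k
  proof -
    obtain l where l: "l \<in> S" "k < l" "l \<le> k + int L" using S by blast
    then show ?thesis by (intro exI[of _ "nat (l - k)"]) auto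
  qed
  show "gap S k \<le> L"
    unfolding gap_def using ex[of k] by (meson Least_le order_trans)
  have mem: "k + int (gap S k) \<in> S" for k
    unfolding gap_def using ex[of k] by (metis LeastI)
  show "gap S k = 0 \<longleftrightarrow> k \<in> S"
  proof
    show "gap S k = 0 \<Longrightarrow> k \<in> S" using mem[of k] by simp
    show "k \<in> S \<Longrightarrow> gap S k = 0" unfolding gap_def by (rule Least_eq_0) simp
  qed
  assume k: "k \<notin> S"
  obtain n where "k + int n \<in> S" using ex by blast
  then have "(LEAST n. k + int n \<in> S) = Suc (LEAST m. k + int (Suc m) \<in> S)"
    using k by (intro Least_Suc) auto
  then show "gap S k = Suc (gap S (k + 1))"
    by (simp add: gap_def algebra_simps)
qed

text \<open>Off the set \<open>S\<close> of sites the subsolution is the self-similar profile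
  \<open>c t\<^sup>a \<phi>\<close>, and at the sites it is \<open>d - K t\<^sup>g\<close>. The parabola \<open>\<gamma>\<close> only has to be compared
  with the next site to the right: a site on the left makes the discrete Laplacian larger.\<close>

lemma subsolution:
  assumes b: "\<beta> \<noteq> 0" "\<beta> < 1" and a: "a = 1 / (1 - \<beta>)"
    and S: "\<And>k. \<exists>l\<in>S. k < l \<and> l \<le> k + int L"
    and \<phi>: "\<And>n. n \<le> L \<Longrightarrow> 0 < \<phi> n" "\<And>n. n \<le> L \<Longrightarrow> Gb \<beta> (\<phi> n) = \<gamma> n"
      "\<And>n. n \<le> L \<Longrightarrow> \<phi> L \<le> \<phi> n" "\<And>n. n \<le> L \<Longrightarrow> \<phi> n \<le> \<phi> 0"
    and \<gamma>: "\<And>n. \<gamma> n - 2 * \<gamma> (Suc n) + \<gamma> (Suc (Suc n)) = 2" "\<And>n. n \<le> Suc L \<Longrightarrow> \<gamma> n \<le> \<gamma> 0"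
    and c: "0 < c" "a * c * \<phi> 0 \<le> 2 * c powr \<beta>"
    and K: "0 < g" "0 < K"
      "2 * Gb \<beta> d - 2 * (c * t powr a) powr \<beta> * Gb \<beta> (\<phi> L) \<le> K * g * t powr (g - 1)"
    and t: "0 < t" "K * t powr g \<le> d / 2" "c * t powr a * \<phi> 0 \<le> d / 2"
    and v: "v = (\<lambda>t k. if k \<in> S then d - K * t powr g else c * t powr a * \<phi> (gap S k))"
    and v': "v' = (\<lambda>t k. if k \<in> S then - K * g * t powr (g - 1)
      else a * c * t powr (a - 1) * \<phi> (gap S k))"
  shows "((\<lambda>s. v s k) has_real_derivative v' t k) (at t)"
    "0 < v t k" "c * t powr a * \<phi> L \<le> v t k" "v' t k \<le> dlap (\<lambda>j. Gb \<beta> (v t j)) k"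
proof -
  note gap = gap_props[OF S]
  define q where "q = (c * t powr a) powr \<beta>"
  have a0: "0 < a" using b a by simp
  have ct: "0 < c * t powr a" using c t by simp
  have q: "0 < q" using c t(1) by (simp add: q_def)
  have d: "0 < d" using t(3) mult_pos_pos[OF ct \<phi>(1)[of 0]] by simp
  have low: "c * t powr a * \<phi> L \<le> v t j" for j
  proof (cases "j \<in> S")
    case True
    have "c * t powr a * \<phi> L \<le> c * t powr a * \<phi> 0" using \<phi>(3)[of 0] ct by (intro mult_left_mono) auto
    then show ?thesis using t True by (simp add: v)
  next
    case False
    then show ?thesis
      using mult_left_mono[OF \<phi>(3)[OF gap(1)[of j]], of "c * t powr a"] ct by (simp add: v)
  qed
  then show "c * t powr a * \<phi> L \<le> v t k" .
  have vpos: "0 < v t j" for j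
    using low[of j] mult_pos_pos[OF ct \<phi>(1)[of L]] by simp
  then show "0 < v t k" .
  have eq: "Gb \<beta> (v t j) = q * \<gamma> (gap S j)" if "j \<notin> S" for j
    using that \<phi>(1,2)[OF gap(1)[of j]] ct c t by (simp add: v Gb_mult q_def)
  \<comment> \<open>The smallness conditions keep a site above \<open>d / 2\<close>, hence above the
    profile at distance 0. So the parabola bounds the flux from below everywhere, with equality off
    \<open>S\<close>.\<close>
  have site: "q * \<gamma> 0 \<le> Gb \<beta> (v t j)" if "j \<in> S" for j
  proof -
    have "c * t powr a * \<phi> 0 \<le> v t j" using that t by (simp add: v)
    then have "Gb \<beta> (c * t powr a * \<phi> 0) \<le> Gb \<beta> (v t j)"
      using b ct \<phi>(1)[of 0] by (intro Gb_mono) auto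
    then show ?thesis using \<phi>(1,2)[of 0] ct by (simp add: Gb_mult q_def)
  qed
  have flux: "q * \<gamma> (gap S j) \<le> Gb \<beta> (v t j)" for j
    using eq[of j] site[of j] gap(2)[of j] by (cases "j \<in> S") auto
  show "((\<lambda>s. v s k) has_real_derivative v' t k) (at t)"
    using t(1) by (auto simp: v v' intro!: derivative_eq_intros)
  show "v' t k \<le> dlap (\<lambda>j. Gb \<beta> (v t j)) k"
  proof (cases "k \<in> S")
    case True
    \<comment> \<open>At a site a crude estimate is enough: both neighbours are at least the
      smallest profile value and the site is at most \<open>d\<close>. The third condition in
      \<open>K\<close> says that the prescribed loss rate covers the resulting outflow.\<close>
    have "q * Gb \<beta> (\<phi> L) \<le> Gb \<beta> (v t j)" for j
    proof -
      have "Gb \<beta> (c * t powr a * \<phi> L) \<le> Gb \<beta> (v t j)"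
        using b ct \<phi>(1)[of L] low by (intro Gb_mono) auto
      then show ?thesis using \<phi>(1)[of L] ct by (simp add: Gb_mult q_def)
    qed
    from this[of "k - 1"] this[of "k + 1"]
    have "2 * (q * Gb \<beta> (\<phi> L)) - 2 * Gb \<beta> (v t k) \<le> dlap (\<lambda>j. Gb \<beta> (v t j)) k"
      by (simp add: dlap_def)
    moreover have "Gb \<beta> (v t k) \<le> Gb \<beta> d"
      using b vpos[of k] True K by (intro Gb_mono) (auto simp: v)
    ultimately show ?thesis using K(3) True by (simp add: v' q_def)
  next
    case False
    define m where "m = gap S (k + 1)"
    have gk: "gap S k = Suc m" using gap(3)[OF False] by (simp add: m_def)
    then have m: "Suc m \<le> L" using gap(1)[of k] by simp
    \<comment> \<open>Either the parabola continues to the left, or a site stands there and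
      contributes its maximum \<open>\<gamma> 0\<close>. In the latter case
      \<open>Suc (Suc m)\<close> may equal \<open>Suc L\<close>, which is why the bound on
      \<open>\<gamma>\<close> reaches that far.\<close>
    have "\<gamma> (Suc (Suc m)) \<le> \<gamma> (gap S (k - 1))"
    proof (cases "k - 1 \<in> S")
      case True
      then have "gap S (k - 1) = 0" using gap(2) by blast
      then show ?thesis using \<gamma>(2)[of "Suc (Suc m)"] m by simp
    next
      case False
      then have "gap S (k - 1) = Suc (Suc m)" using gap(3)[OF False] gk by simp
      then show ?thesis by simp
    qed
    from order_trans[OF mult_left_mono[OF this less_imp_le[OF q]] flux]
    have "q * \<gamma> (Suc (Suc m)) \<le> Gb \<beta> (v t (k - 1))" .
    moreover have "q * \<gamma> m \<le> Gb \<beta> (v t (k + 1))"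
      using flux[of "k + 1"] by (simp add: m_def)
    moreover have "q * (\<gamma> m - 2 * \<gamma> (Suc m) + \<gamma> (Suc (Suc m))) = q * 2"
      by (simp only: \<gamma>(1))
    ultimately have dl: "2 * q \<le> dlap (\<lambda>j. Gb \<beta> (v t j)) k"
      using eq[OF False] gk by (simp add: dlap_def algebra_simps)
    have "a - 1 = a * \<beta>" using a b by (simp add: field_simps)
    then have q': "q = c powr \<beta> * t powr (a - 1)"
      using c t by (simp add: q_def powr_mult powr_powr)
    have "a * c * \<phi> (Suc m) \<le> a * c * \<phi> 0"
      using a0 c \<phi>(4)[OF m] by (intro mult_left_mono) auto
    then have "a * c * \<phi> (Suc m) * t powr (a - 1) \<le> 2 * c powr \<beta> * t powr (a - 1)"
      using c(2) by (intro mult_right_mono) auto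
    then have "v' t k \<le> 2 * q" using False gk by (simp add: v' q' mult_ac)
    then show ?thesis using dl by simp
  qed
qed

text \<open>\<open>c\<close> solves \<open>a * c * \<Phi> = 2 * c powr \<beta>\<close> with
  equality. For \<beta> > 0 the outflow from a site is at most \<open>2 * Gb \<beta> d\<close>, so a
  linear loss, \<open>g = 1\<close>, suffices. For \<beta> < 0 it is driven by the nearly empty
  neighbours and of order t^(a - 1), whose primitive forces \<open>g = a\<close>.\<close>

lemma subsolution_constants:
  assumes b: "\<beta> \<noteq> 0" "\<beta> < 1" and a: "a = 1 / (1 - \<beta>)" and d: "0 < d"
    and P: "0 < \<Phi>" "0 < \<psi>"
  obtains c g K \<tau> where "0 < c" "a * c * \<Phi> \<le> 2 * c powr \<beta>" "0 < g" "0 < K" "0 < \<tau>" "\<tau> \<le> 1"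
    "\<And>t. 0 < t \<Longrightarrow> 2 * Gb \<beta> d - 2 * (c * t powr a) powr \<beta> * Gb \<beta> \<psi> \<le> K * g * t powr (g - 1)"
    "\<And>t. 0 \<le> t \<Longrightarrow> t \<le> \<tau> \<Longrightarrow> K * t powr g \<le> d / 2"
    "\<And>t. 0 \<le> t \<Longrightarrow> t \<le> \<tau> \<Longrightarrow> c * t powr a * \<Phi> \<le> d / 2"
proof -
  have a0: "0 < a" using a b by simp
  define c where "c = (2 / (a * \<Phi>)) powr a"
  have c: "0 < c" using a0 P by (simp add: c_def)
  have "a * (1 - \<beta>) = 1" using a b by simp
  then have "c powr (1 - \<beta>) = 2 / (a * \<Phi>)" using a0 P by (simp add: c_def powr_powr)
  moreover have "c = c powr \<beta> * c powr (1 - \<beta>)" using c by (simp add: powr_add[symmetric])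
  ultimately have "c * (a * \<Phi>) = c powr \<beta> * (2 / (a * \<Phi>)) * (a * \<Phi>)" by metis
  then have c2: "a * c * \<Phi> \<le> 2 * c powr \<beta>" using a0 P by (simp add: mult_ac)
  have "\<exists>g K. 0 < g \<and> 0 < K \<and> (\<forall>t>0. 2 * Gb \<beta> d - 2 * (c * t powr a) powr \<beta> * Gb \<beta> \<psi> \<le> K * g * t powr (g - 1))"
  proof (cases "0 < \<beta>")
    case True
    then show ?thesis
      using d by (intro exI[of _ 1] exI[of _ "2 * Gb \<beta> d"]) (auto simp: Gb_def)
  next
    case False
    then have neg: "\<beta> < 0" using b by simp
    have ab: "a * \<beta> = a - 1" using a b by (simp add: field_simps)
    have "2 * Gb \<beta> d - 2 * (c * t powr a) powr \<beta> * Gb \<beta> \<psi>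
      \<le> 2 * c powr \<beta> * \<psi> powr \<beta> / a * a * t powr (a - 1)" if "0 < t" for t
      proof -
      have "(c * t powr a) powr \<beta> = c powr \<beta> * t powr (a - 1)"
        using c that by (simp add: powr_mult powr_powr ab)
      then show ?thesis using a0 neg by (simp add: Gb_def mult_ac)
    qed
    then show ?thesis
      using a0 P c by (intro exI[of _ a] exI[of _ "2 * c powr \<beta> * \<psi> powr \<beta> / a"]) auto
  qed
  then obtain g K where g: "0 < g" "0 < K"
    "\<And>t. 0 < t \<Longrightarrow> 2 * Gb \<beta> d - 2 * (c * t powr a) powr \<beta> * Gb \<beta> \<psi> \<le> K * g * t powr (g - 1)"
    by blast
  obtain \<tau>1 where \<tau>1: "0 < \<tau>1" "\<And>t. 0 \<le> t \<Longrightarrow> t \<le> \<tau>1 \<Longrightarrow> t powr g \<le> d / 2 / K"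
    using powr_eventually_small[of g "d / 2 / K"] g d by auto
  obtain \<tau>2 where \<tau>2: "0 < \<tau>2" "\<And>t. 0 \<le> t \<Longrightarrow> t \<le> \<tau>2 \<Longrightarrow> t powr a \<le> d / 2 / (c * \<Phi>)"
    using powr_eventually_small[of a "d / 2 / (c * \<Phi>)"] a0 d c P by auto
  show thesis
  proof
    show "K * t powr g \<le> d / 2" if "0 \<le> t" "t \<le> min 1 (min \<tau>1 \<tau>2)" for t
      using \<tau>1(2)[of t] that g by (simp add: field_simps)
    show "c * t powr a * \<Phi> \<le> d / 2" if "0 \<le> t" "t \<le> min 1 (min \<tau>1 \<tau>2)" for t
      using \<tau>2(2)[of t] that c P by (simp add: field_simps)
  qed (use c c2 g \<tau>1 \<tau>2 in auto)
qed

lemma flow_bounds: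
  assumes "mono F" and "\<And>x y. \<bar>F x - F y\<bar> \<le> K * \<bar>x - y\<bar>" and "flow F u" and "0 \<le> t"
  shows "(\<And>k. c \<le> u 0 k) \<Longrightarrow> c \<le> u t k" "(\<And>k. u 0 k \<le> c) \<Longrightarrow> u t k \<le> c"
  using flow_mono[OF assms(1,2,3) flow_const _ assms(4)]
    flow_mono[OF assms(1,2) flow_const assms(3) _ assms(4)] by auto

lemma continuous_on_powr_nonneg:
  fixes p :: real
  assumes "0 < p" "S \<subseteq> {0..}"
  shows "continuous_on S (\<lambda>t. t powr p)"
  using assms by (intro continuous_on_powr' continuous_intros) auto

section \<open>Lower bound uniform in the regularisation\<close>

text \<open>\<open>c\<close> is fixed before \<open>e\<close> and \<open>u\<close>; only the set of
  sites is read off from \<open>u\<close>. The subsolution works up to \<open>\<tau>\<close>;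
  afterwards the minimum reached persists, since constants solve the equation. This produces the
  minimum with 1.\<close>

lemma flow_lower_bound:
  assumes b: "\<beta> \<noteq> 0" "\<beta> < 1" and d: "0 < d" and L: "1 \<le> L"
  obtains c where "0 < c"
    "\<forall>e>0. \<forall>u. flow (Gb_cut \<beta> e) u \<and> (\<forall>k. e \<le> u 0 k) \<and>
      (\<forall>k. \<exists>l. k < l \<and> l \<le> k + int L \<and> d \<le> u 0 l) \<longrightarrow>
      (\<forall>t\<ge>0. \<forall>k. c * min 1 (t powr (1 / (1 - \<beta>))) \<le> u t k)"
proof -
  define a where "a = 1 / (1 - \<beta>)"
  have a0: "0 < a" using b by (simp add: a_def)
  obtain \<phi> \<gamma> :: "nat \<Rightarrow> real" where \<phi>:
    "\<And>n. n \<le> L \<Longrightarrow> 0 < \<phi> n" "\<And>n. n \<le> L \<Longrightarrow> Gb \<beta> (\<phi> n) = \<gamma> n"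
    "\<And>n. n \<le> L \<Longrightarrow> \<phi> L \<le> \<phi> n" "\<And>n. n \<le> L \<Longrightarrow> \<phi> n \<le> \<phi> 0"
    and \<gamma>: "\<And>n. \<gamma> n - 2 * \<gamma> (Suc n) + \<gamma> (Suc (Suc n)) = 2"
    "\<And>n. n \<le> Suc L \<Longrightarrow> \<gamma> n \<le> \<gamma> 0"
    using gap_profile[OF b(1) L] by metis
  obtain c g K \<tau> where c: "0 < c" "a * c * \<phi> 0 \<le> 2 * c powr \<beta>" and g: "0 < g" "0 < K"
    and \<tau>: "0 < \<tau>" "\<tau> \<le> 1"
    and gK: "\<And>t. 0 < t \<Longrightarrow> 2 * Gb \<beta> d - 2 * (c * t powr a) powr \<beta> * Gb \<beta> (\<phi> L) \<le> K * g * t powr (g - 1)"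
    and small: "\<And>t. 0 \<le> t \<Longrightarrow> t \<le> \<tau> \<Longrightarrow> K * t powr g \<le> d / 2"
      "\<And>t. 0 \<le> t \<Longrightarrow> t \<le> \<tau> \<Longrightarrow> c * t powr a * \<phi> 0 \<le> d / 2"
    by (rule subsolution_constants[OF b a_def d \<phi>(1)[OF le0] \<phi>(1)[OF order_refl]]) blast
  \<comment> \<open>The least profile value at time \<open>\<tau>\<close>. As
    \<open>\<tau> \<le> 1\<close>, it is also at most \<open>c * \<phi> L\<close>, so it can replace
    that coefficient of the power of t at early times.\<close>
  define c' where "c' = c * \<tau> powr a * \<phi> L"
  have c': "0 < c'" using c \<tau> \<phi>(1)[of L] by (simp add: c'_def)
  have "c' * min 1 (t powr (1 / (1 - \<beta>))) \<le> u t k"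
    if e: "0 < e" and u: "flow (Gb_cut \<beta> e) u" and ue: "\<And>k. e \<le> u 0 k"
      and site: "\<And>k. \<exists>l. k < l \<and> l \<le> k + int L \<and> d \<le> u 0 l" and t: "0 \<le> t"
    for e u t k
  proof -
    have b1: "\<beta> \<le> 1" using b by simp
    note mono = mono_Gb_cut[OF b(1) b1 e] and lip = Gb_cut_lipschitz[OF b(1) b1 e]
    have ue: "e \<le> u t k" if "0 \<le> t" for t k
      by (rule flow_bounds(1)[OF mono lip u that ue])
    define S where "S = {l. d \<le> u 0 l}"
    have S: "\<exists>l\<in>S. k < l \<and> l \<le> k + int L" for k
      using site by (auto simp: S_def)
    define v where "v = (\<lambda>t k. if k \<in> S then d - K * t powr g else c * t powr a * \<phi> (gap S k))"
    define v' where "v' = (\<lambda>t k. if k \<in> S then - K * g * t powr (g - 1)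
      else a * c * t powr (a - 1) * \<phi> (gap S k))"
    have sub: "((\<lambda>s. v s k) has_real_derivative v' t k) (at t)"
      "0 < v t k" "c * t powr a * \<phi> L \<le> v t k" "v' t k \<le> dlap (\<lambda>j. Gb \<beta> (v t j)) k"
      if "0 < t" "t \<le> \<tau>" for t k
      using subsolution[OF b a_def S \<phi> \<gamma> c g gK[OF that(1)] that(1) small[OF less_imp_le[OF that(1)] that(2)] v_def v'_def]
      by auto
    have uc: "continuous_on {0..} (\<lambda>t. u t k)"
      and ud: "0 < t \<Longrightarrow> ((\<lambda>s. u s k) has_real_derivative dlap (\<lambda>j. Gb_cut \<beta> e (u t j)) k) (at t)" for k t
      using u by (auto simp: flow_def)
    have early: "v t k \<le> u t k" if t: "0 \<le> t" "t \<le> \<tau>" for t k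
    proof (rule comparison_principle[OF mono lip, where a = 0 and b = \<tau> and B = d and u = u and v = v
          and u' = "\<lambda>t. dlap (\<lambda>j. Gb_cut \<beta> e (u t j))" and v' = v'])
      show "continuous_on {0..\<tau>} (\<lambda>t. u t k)" for k
        using uc by (rule continuous_on_subset) auto
      show "continuous_on {0..\<tau>} (\<lambda>t. v t k)" for k
      proof (cases "k \<in> S")
        case True
        then show ?thesis using g by (simp add: v_def) (intro continuous_intros continuous_on_powr_nonneg; simp)
      next
        case False
        then show ?thesis using a0 by (simp add: v_def) (intro continuous_intros continuous_on_powr_nonneg; simp)
      qed
      show "v s j - u s j \<le> d" if "0 \<le> s" "s \<le> \<tau>" for s j
      proof -
        have "c * s powr a * \<phi> (gap S j) \<le> c * s powr a * \<phi> 0"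
          using c \<phi>(4)[OF gap_props(1)[OF S, of j]] by (intro mult_left_mono) auto
        then have "v s j \<le> d" using small[of s] that d g by (auto simp: v_def)
        then show ?thesis using ue[of s j] that e by simp
      qed
      show "v 0 j \<le> u 0 j" for j
        using ue[of 0 j] e by (auto simp: v_def S_def)
      show "v' s j - dlap (\<lambda>j. Gb_cut \<beta> e (u s j)) j
        \<le> dlap (\<lambda>j. Gb_cut \<beta> e (v s j)) j - dlap (\<lambda>j. Gb_cut \<beta> e (u s j)) j"
        if s: "0 < s" "s < \<tau>" and uv: "u s j < v s j" for s j
      proof -
        \<comment> \<open>Truncation can only raise the flux at the neighbours, and at
          \<open>j\<close> itself it is inactive because \<open>v > u \<ge> e\<close> there. So the
          Laplacian does not decrease and \<open>v\<close> stays a subsolution.\<close>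
        have "Gb \<beta> (v s i) \<le> Gb \<beta> (max e (v s i))" for i
          using sub(2)[of s i] s b by (intro Gb_mono) auto
        moreover have "max e (v s j) = v s j" using ue[of s j] s uv by simp
        ultimately have "dlap (\<lambda>j. Gb \<beta> (v s j)) j \<le> dlap (\<lambda>j. Gb_cut \<beta> e (v s j)) j"
          by (simp add: dlap_def Gb_cut_def add_mono)
        then show ?thesis using sub(4)[of s j] s by simp
      qed
    qed (use sub(1) ud t in auto)
    have early': "c * t powr a * \<phi> L \<le> u t k" if "0 \<le> t" "t \<le> \<tau>" for t k
    proof (cases "t = 0")
      case True
      then show ?thesis using ue[of 0 k] e by simp
    next
      case False
      then show ?thesis using sub(3)[of t k] early[of t k] that by simp
    qed
    show ?thesis
    proof (cases "t \<le> \<tau>")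
      case True
      have "\<tau> powr a \<le> 1 powr a" using \<tau> a0 by (intro powr_mono2) auto
      then have "c * \<tau> powr a * \<phi> L \<le> c * 1 * \<phi> L"
        using c \<phi>(1)[of L] by (intro mult_right_mono mult_left_mono) auto
      then have "c' * min 1 (t powr a) \<le> (c * \<phi> L) * t powr a"
        unfolding c'_def using c \<phi>(1)[of L] by (intro mult_mono) auto
      then show ?thesis using early'[OF t True, of k] by (simp add: a_def mult_ac)
    next
      case False
      have "c' \<le> u t k"
      proof (rule comparison_principle[OF mono lip, where a = \<tau> and b = t and B = c' and u = u
            and v = "\<lambda>_ _. c'" and u' = "\<lambda>t. dlap (\<lambda>j. Gb_cut \<beta> e (u t j))" and v' = "\<lambda>_ _. 0"])
        show "continuous_on {\<tau>..t} (\<lambda>t. u t k)" for k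
          using uc by (rule continuous_on_subset) (use \<tau> in auto)
        show "c' - u s j \<le> c'" if "\<tau> \<le> s" for s j
          using ue[of s j] e \<tau> that by simp
        show "c' \<le> u \<tau> j" for j
          using early'[of \<tau> j] \<tau> by (simp add: c'_def)
      qed (use ud \<tau> False in \<open>auto simp: dlap_def[of "\<lambda>_. Gb_cut \<beta> e c'"]\<close>)
      moreover have "c' * min 1 (t powr a) \<le> c' * 1" using c' by (intro mult_left_mono) auto
      ultimately show ?thesis by (simp add: a_def)
    qed
  qed
  then show thesis using that[OF c'] by blast
qed

section \<open>Removing the regularisation\<close>

text \<open>A flow above \<open>e\<close> does not see a truncation at or below \<open>e\<close>.
  Hence two members of the regularised family can be compared as flows of a single equation, the one
  with the lower truncation.\<close>

lemma flow_Gb_cut_change: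
  assumes u: "flow (Gb_cut \<beta> e) u" and e: "\<And>t k. 0 \<le> t \<Longrightarrow> e \<le> u t k" and "e' \<le> e"
  shows "flow (Gb_cut \<beta> e') u"
proof -
  have "dlap (\<lambda>j. Gb_cut \<beta> e' (u t j)) k = dlap (\<lambda>j. Gb_cut \<beta> e (u t j)) k" if "0 < t" for t k
    using e[of t] that \<open>e' \<le> e\<close> by (subst (1 2) dlap_Gb_cut) (auto intro: order_trans)
  then show ?thesis using u by (simp add: flow_def)
qed

text \<open>Both \<open>h - f\<close> and \<open>h + f\<close> are nondecreasing. Derivatives are
  taken in the open interval only, because the majorant may be singular at time 0.\<close>

lemma abs_diff_le_of_derivative:
  fixes f h :: "real \<Rightarrow> real"
  assumes "s \<le> t" "continuous_on {s..t} f" "continuous_on {s..t} h"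
    and f: "\<And>x. s < x \<Longrightarrow> x < t \<Longrightarrow> (f has_real_derivative f' x) (at x)"
    and h: "\<And>x. s < x \<Longrightarrow> x < t \<Longrightarrow> (h has_real_derivative h' x) (at x)"
    and le: "\<And>x. s < x \<Longrightarrow> x < t \<Longrightarrow> \<bar>f' x\<bar> \<le> h' x"
  shows "\<bar>f t - f s\<bar> \<le> h t - h s"
proof -
  have "h s - f s \<le> h t - f t"
  proof (rule DERIV_nonneg_imp_increasing_open[OF \<open>s \<le> t\<close>, of "\<lambda>x. h x - f x"])
    show "\<exists>y. ((\<lambda>x. h x - f x) has_real_derivative y) (at x) \<and> 0 \<le> y" if "s < x" "x < t" for x
      using le[OF that] by (intro exI[of _ "h' x - f' x"] conjI DERIV_diff f h that) auto
  qed (intro continuous_intros assms)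
  moreover have "h s + f s \<le> h t + f t"
  proof (rule DERIV_nonneg_imp_increasing_open[OF \<open>s \<le> t\<close>, of "\<lambda>x. h x + f x"])
    show "\<exists>y. ((\<lambda>x. h x + f x) has_real_derivative y) (at x) \<and> 0 \<le> y" if "s < x" "x < t" for x
      using le[OF that] by (intro exI[of _ "h' x + f' x"] conjI DERIV_add f h that) auto
  qed (intro continuous_intros assms)
  ultimately show ?thesis by simp
qed

text \<open>For \<beta> > 0 the upper bound \<open>B\<close> controls the flux and the exponent of t
  is 0. For \<beta> < 0 the lower bound does, and raising it to the power \<beta> gives the exponent
  a \<beta> = a - 1 with a = 1 / (1 - \<beta>) < 1. The minimum in the exponent unites the two
  cases.\<close>

lemma Gb_bound:
  assumes b: "\<beta> \<noteq> 0" "\<beta> < 1" and c: "0 < c" and t: "0 < t"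
    and x: "c * min 1 (t powr (1 / (1 - \<beta>))) \<le> x" "x \<le> B"
  shows "\<bar>Gb \<beta> x\<bar> \<le> max (B powr \<beta>) (c powr \<beta>) * (1 + t powr (min 1 (1 / (1 - \<beta>)) - 1))"
proof -
  define m where "m = min 1 (t powr (1 / (1 - \<beta>)))"
  have m: "0 < m" "m \<le> 1" using t by (auto simp: m_def)
  have x0: "0 < x" using x(1) mult_pos_pos[OF c m(1)] by (simp add: m_def)
  have G: "\<bar>Gb \<beta> x\<bar> = x powr \<beta>" using b by (simp add: Gb_def abs_mult)
  show ?thesis
  proof (cases "0 < \<beta>")
    case True
    have "x powr \<beta> \<le> B powr \<beta>" using x0 x True by (intro powr_mono2) auto
    also have "\<dots> \<le> max (B powr \<beta>) (c powr \<beta>) * 1" by simp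
    also have "\<dots> \<le> max (B powr \<beta>) (c powr \<beta>) * (1 + t powr (min 1 (1 / (1 - \<beta>)) - 1))"
      by (intro mult_left_mono) (auto simp: le_max_iff_disj)
    finally show ?thesis by (simp add: G)
  next
    case False
    then have neg: "\<beta> < 0" using b by simp
    have "x powr \<beta> \<le> (c * m) powr \<beta>"
      using x(1) mult_pos_pos[OF c m(1)] neg by (intro powr_mono2') (auto simp: m_def)
    also have "\<dots> = c powr \<beta> * m powr \<beta>" using c m by (simp add: powr_mult)
    also have "m powr \<beta> \<le> 1 + t powr (min 1 (1 / (1 - \<beta>)) - 1)"
    proof (cases "t powr (1 / (1 - \<beta>)) \<le> 1")
      case True
      have "1 / (1 - \<beta>) * \<beta> = min 1 (1 / (1 - \<beta>)) - 1"
        using neg by (simp add: min_def field_simps)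
      then show ?thesis using True by (simp add: m_def min_absorb2 powr_powr)
    qed (simp add: m_def)
    finally show ?thesis using G
      by (smt (verit, ccfv_SIG) max.cobounded2 mult_right_mono mult_left_mono powr_ge_zero)
  qed
qed

text \<open>The flux bound of \<open>Gb_bound\<close> is integrable at \<open>t = 0\<close>, which gives a modulus of continuity
  in time that survives the limit \<open>e \<rightarrow> 0\<close>.\<close>

lemma nonlinear_solution:
  assumes b: "\<beta> \<noteq> 0" "\<beta> < 1"
    and c: "0 < c"
    "\<forall>e>0. \<forall>u. flow (Gb_cut \<beta> e) u \<and> (\<forall>k. e \<le> u 0 k) \<and>
      (\<forall>k. \<exists>l. k < l \<and> l \<le> k + int L \<and> d \<le> u 0 l) \<longrightarrow>
      (\<forall>t\<ge>0. \<forall>k. c * min 1 (t powr (1 / (1 - \<beta>))) \<le> u t k)"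
    and u0: "u0 \<in> P_class L d"
  obtains u where "is_solution \<beta> u0 u"
    "\<And>t k. 0 \<le> t \<Longrightarrow> c * min 1 (t powr (1 / (1 - \<beta>))) \<le> u t k"
    "\<And>c t k. 0 \<le> t \<Longrightarrow> (\<And>k. c \<le> u0 k) \<Longrightarrow> c \<le> u t k"
    "\<And>c t k. 0 \<le> t \<Longrightarrow> (\<And>k. u0 k \<le> c) \<Longrightarrow> u t k \<le> c"
proof -
  have b1: "\<beta> \<le> 1" using b by simp
  have u0': "bounded (range u0)" "\<And>k. 0 \<le> u0 k"
    using u0 by (auto simp: P_class_def linf_plus_def)
  obtain M where M: "\<And>k. \<bar>u0 k\<bar> \<le> M" using u0'(1) by (auto simp: bounded_iff)
  define e where "e n = inverse (real (Suc n))" for n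
  have e: "0 < e n" "e n \<le> 1" "e (Suc n) \<le> e n" for n
    by (auto simp: e_def field_simps)
  have e_lim: "e \<longlonglongrightarrow> 0"
    unfolding e_def using LIMSEQ_inverse_real_of_nat by simp
  have "\<exists>u. flow (Gb_cut \<beta> (e n)) u \<and> u 0 = (\<lambda>k. u0 k + e n)" for n
  proof (rule flow_exists[OF Gb_cut_lipschitz[OF b(1) b1 e(1)]])
    show "Gb_cut \<beta> (e n) 0 = 0" using e(1)[of n] by (simp add: Gb_cut_def)
    show "\<bar>u0 k + e n\<bar> \<le> M + 1" for k using M[of k] e[of n] by linarith
  qed
  then obtain U where U: "\<And>n. flow (Gb_cut \<beta> (e n)) (U n)" "\<And>n. U n 0 = (\<lambda>k. u0 k + e n)"
    by metis
  note mono = mono_Gb_cut[OF b(1) b1 e(1)] and lip = Gb_cut_lipschitz[OF b(1) b1 e(1)]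
  have lower: "c1 + e n \<le> U n t k" if "0 \<le> t" "\<And>k. c1 \<le> u0 k" for n t k c1
    by (rule flow_bounds(1)[OF mono lip U(1) that(1)]) (simp add: U(2) that)
  have upper: "U n t k \<le> c2 + e n" if "0 \<le> t" "\<And>k. u0 k \<le> c2" for n t k c2
    by (rule flow_bounds(2)[OF mono lip U(1) that(1)]) (simp add: U(2) that)
  have Ue: "e n \<le> U n t k" if "0 \<le> t" for n t k
    using lower[OF that, of 0] u0'(2) by simp
  have UM: "U n t k \<le> M + 1" if "0 \<le> t" for n t k
    using upper[OF that, of M n k] M abs_le_D1[OF M] e(2)[of n] by fastforce
  have anti: "U (Suc n) t k \<le> U n t k" if "0 \<le> t" for n t k
  proof (rule flow_mono[OF mono lip _ U(1) _ that])
    show "flow (Gb_cut \<beta> (e (Suc n))) (U n)"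
      by (rule flow_Gb_cut_change[OF U(1) Ue e(3)])
  qed (use e(3)[of n] in \<open>simp add: U(2)\<close>)
  have Uc: "c * min 1 (t powr (1 / (1 - \<beta>))) \<le> U n t k" if "0 \<le> t" for n t k
  proof -
    have "e n \<le> U n 0 k" for k by (rule Ue) simp
    moreover have "\<exists>l>k. l \<le> k + int L \<and> d \<le> U n 0 l" for k
    proof -
      obtain l where "k < l" "l \<le> k + int L" "d \<le> u0 l" using P_class_site[OF u0] by blast
      then show ?thesis using e(1)[of n] by (intro exI[of _ l]) (simp add: U(2))
    qed
    ultimately show ?thesis using c(2) e(1)[of n] U(1)[of n] that by blast
  qed
  define g where "g = min 1 (1 / (1 - \<beta>))"
  have g: "0 < g" using b by (simp add: g_def)
  \<comment> \<open>The 4 comes from \<open>abs_dlap_le\<close>; \<open>M + 1\<close> bounds every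
    \<open>U n\<close> because \<open>e n \<le> 1\<close>.\<close>
  define C where "C = 4 * max ((M + 1) powr \<beta>) (c powr \<beta>)"
  have C: "0 \<le> C" by (simp add: C_def le_max_iff_disj)
  define h where "h t = C * (1 + t powr (g - 1))" for t
  define H where "H t = C * (t + t powr g / g)" for t
  have HD: "(H has_real_derivative h t) (at t)" if "0 < t" for t
    unfolding H_def[abs_def] h_def using that g by (auto intro!: derivative_eq_intros)
  have Hc: "continuous_on {0..} H"
    unfolding H_def[abs_def] using g
    by (intro continuous_intros continuous_on_powr_nonneg) auto
  define D where "D n t k = dlap (\<lambda>j. Gb \<beta> (U n t j)) k" for n t k
  have UD: "((\<lambda>s. U n s k) has_real_derivative D n t k) (at t)" if "0 < t" for n t k
  proof -
    have "dlap (\<lambda>j. Gb_cut \<beta> (e n) (U n t j)) k = D n t k"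
      unfolding D_def using that by (intro dlap_Gb_cut Ue) simp
    then show ?thesis using U(1)[of n] that unfolding flow_def by metis
  qed
  have Ucont: "continuous_on {0..} (\<lambda>t. U n t k)" for n k
    using U(1) by (auto simp: flow_def)
  have D_bound: "\<bar>D n t k\<bar> \<le> h t" if "0 < t" for n t k
  proof -
    have "\<bar>Gb \<beta> (U n t j)\<bar> \<le> max ((M + 1) powr \<beta>) (c powr \<beta>) * (1 + t powr (g - 1))" for j
      unfolding g_def using that by (intro Gb_bound b c(1) Uc UM) auto
    from abs_dlap_le[OF this] show ?thesis by (simp add: D_def h_def C_def mult.assoc)
  qed
  have modulus: "\<bar>U n t k - U n s k\<bar> \<le> H t - H s" if "0 \<le> s" "s \<le> t" for n s t k
  proof (rule abs_diff_le_of_derivative[OF that(2)])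
    show "continuous_on {s..t} (\<lambda>t. U n t k)" "continuous_on {s..t} H"
      using that by (auto intro!: continuous_on_subset[OF Ucont] continuous_on_subset[OF Hc])
    show "((\<lambda>t. U n t k) has_real_derivative D n x k) (at x)" if "s < x" for x
      using UD \<open>0 \<le> s\<close> that by simp
    show "(H has_real_derivative h x) (at x)" if "s < x" for x
      using HD \<open>0 \<le> s\<close> that by simp
    show "\<bar>D n x k\<bar> \<le> h x" if "s < x" for x using D_bound \<open>0 \<le> s\<close> that by simp
  qed
  have "\<exists>l. (\<lambda>n. U n t k) \<longlonglongrightarrow> l" if "0 \<le> t" for t k
  proof -
    have "decseq (\<lambda>n. U n t k)" using anti[OF that] by (rule decseq_SucI)
    moreover have "0 \<le> U n t k" for n using Ue[OF that, of n k] e(1)[of n] by linarith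
    ultimately show ?thesis using decseq_convergent by metis
  qed
  then obtain u where u: "\<And>t k. 0 \<le> t \<Longrightarrow> (\<lambda>n. U n t k) \<longlonglongrightarrow> u t k"
    by metis
  have u_lower: "c1 \<le> u t k" if "0 \<le> t" "\<And>k. c1 \<le> u0 k" for c1 t k
  proof (rule LIMSEQ_le_const[OF u[OF that(1)]])
    show "\<exists>N. \<forall>n\<ge>N. c1 \<le> U n t k"
      using lower[OF that] e(1) by (meson add_increasing2 less_imp_le order_trans le_add_same_cancel1)
  qed
  have u_upper: "u t k \<le> c2" if "0 \<le> t" "\<And>k. u0 k \<le> c2" for c2 t k
  proof (rule LIMSEQ_le[OF u[OF that(1)]])
    show "(\<lambda>n. c2 + e n) \<longlonglongrightarrow> c2" using tendsto_add[OF tendsto_const e_lim, of c2] by simp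
  qed (use upper[OF that] in auto)
  have u_c: "c * min 1 (t powr (1 / (1 - \<beta>))) \<le> u t k" if "0 \<le> t" for t k
    by (rule LIMSEQ_le_const[OF u[OF that]]) (use Uc[OF that] in auto)
  have u_pos: "0 < u t k" if "0 < t" for t k
  proof (rule less_le_trans[OF _ u_c])
    show "0 < c * min 1 (t powr (1 / (1 - \<beta>)))" using c(1) that by simp
  qed (use that in simp)
  have u_modulus': "\<bar>u t k - u s k\<bar> \<le> H t - H s" if "0 \<le> s" "s \<le> t" for s t k
  proof (rule LIMSEQ_le_const2)
    show "(\<lambda>n. \<bar>U n t k - U n s k\<bar>) \<longlonglongrightarrow> \<bar>u t k - u s k\<bar>"
      using that by (intro tendsto_intros u) auto
  qed (use modulus[OF that] in auto)
  have u_modulus: "\<bar>u t k - u s k\<bar> \<le> \<bar>H t - H s\<bar>" if "0 \<le> s" "0 \<le> t" for s t k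
    using u_modulus'[of s t k] u_modulus'[of t s k] that by (cases "s \<le> t") auto
  \<comment> \<open>The modulus \<open>H\<close> does not involve \<open>k\<close>, so continuity of
    the single function \<open>H\<close>, including at 0, gives continuity in the sup norm.\<close>
  have equi: "\<exists>\<delta>>0. \<forall>t\<ge>0. \<bar>t - t0\<bar> < \<delta> \<longrightarrow> (\<forall>k. \<bar>u t k - u t0 k\<bar> \<le> \<epsilon>)"
    if t0: "0 \<le> t0" and "0 < \<epsilon>" for t0 \<epsilon>
  proof -
    obtain \<delta> where \<delta>: "0 < \<delta>" "\<And>t. 0 \<le> t \<Longrightarrow> \<bar>t - t0\<bar> < \<delta> \<Longrightarrow> \<bar>H t - H t0\<bar> < \<epsilon>"
      using Hc t0 \<open>0 < \<epsilon>\<close> unfolding continuous_on_iff dist_real_def by (metis atLeast_iff)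
    show ?thesis
      using \<delta> u_modulus[OF t0] by (intro exI[of _ \<delta>]) (auto intro: order_trans[OF _ less_imp_le])
  qed
  have u_cont: "continuous_on {0<..} (\<lambda>t. u t k)" for k
    unfolding continuous_on_iff dist_real_def
  proof (intro ballI allI impI)
    fix t0 \<epsilon> :: real assume "t0 \<in> {0<..}" "0 < \<epsilon>"
    then obtain \<delta> where \<delta>: "0 < \<delta>" "\<And>t. 0 \<le> t \<Longrightarrow> \<bar>t - t0\<bar> < \<delta> \<Longrightarrow> \<bar>u t k - u t0 k\<bar> \<le> \<epsilon> / 2"
      using equi[of t0 "\<epsilon> / 2"] by auto
    have "\<bar>u t k - u t0 k\<bar> < \<epsilon>" if "t \<in> {0<..}" "\<bar>t - t0\<bar> < \<delta>" for t
    proof -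
      have "\<bar>u t k - u t0 k\<bar> \<le> \<epsilon> / 2" using \<delta>(2)[of t] that by simp
      then show ?thesis using \<open>0 < \<epsilon>\<close> by simp
    qed
    then show "\<exists>\<delta>>0. \<forall>t\<in>{0<..}. \<bar>t - t0\<bar> < \<delta> \<longrightarrow> \<bar>u t k - u t0 k\<bar> < \<epsilon>"
      using \<delta>(1) by blast
  qed
  have G_cont: "isCont (Gb \<beta>) x" if "0 < x" for x
    using Gb_has_derivative[OF b(1) that] by (rule DERIV_isCont)
  have Gu_cont: "continuous_on {0<..} (\<lambda>t. dlap (\<lambda>j. Gb \<beta> (u t j)) k)" for k
  proof -
    have "continuous_on {0<..} (\<lambda>t. Gb \<beta> (u t j))" for j
    proof (rule continuous_on_compose2[OF _ u_cont])
      show "continuous_on {0<..} (Gb \<beta>)"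
        using G_cont by (intro continuous_at_imp_continuous_on) auto
    qed (use u_pos in auto)
    then show ?thesis unfolding dlap_def by (intro continuous_intros)
  qed
  \<comment> \<open>Only pointwise convergence of the derivatives is available, so the limit is
    taken in the integrated equation, with \<open>h\<close> as dominating function.\<close>
  have integral_eq: "((\<lambda>r. dlap (\<lambda>j. Gb \<beta> (u r j)) k) has_integral u t k - u s k) {s..t}"
    if s: "0 < s" "s \<le> t" for s t k
  proof (rule has_integral_dominated_convergence)
    show "((\<lambda>r. D n r k) has_integral U n t k - U n s k) {s..t}" for n
      using s by (intro fundamental_theorem_of_calculus)
        (auto simp: has_real_derivative_iff_has_vector_derivative[symmetric]
          intro!: has_field_derivative_at_within UD)
    have "(h has_integral H t - H s) {s..t}"
      using s by (intro fundamental_theorem_of_calculus)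
        (auto simp: has_real_derivative_iff_has_vector_derivative[symmetric]
          intro!: has_field_derivative_at_within HD)
    then show "h integrable_on {s..t}" by blast
    show "\<forall>r\<in>{s..t}. norm (D n r k) \<le> h r" for n using D_bound s by auto
    show "\<forall>r\<in>{s..t}. (\<lambda>n. D n r k) \<longlonglongrightarrow> dlap (\<lambda>j. Gb \<beta> (u r j)) k"
    proof
      fix r assume "r \<in> {s..t}"
      then have r: "0 < r" using s by simp
      have "(\<lambda>n. Gb \<beta> (U n r j)) \<longlonglongrightarrow> Gb \<beta> (u r j)" for j
        using isCont_tendsto_compose[OF G_cont[OF u_pos[OF r]] u] r by simp
      then show "(\<lambda>n. D n r k) \<longlonglongrightarrow> dlap (\<lambda>j. Gb \<beta> (u r j)) k"
        unfolding D_def dlap_def by (intro tendsto_intros)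
    qed
    show "(\<lambda>n. U n t k - U n s k) \<longlonglongrightarrow> u t k - u s k"
      using s by (intro tendsto_intros u) auto
  qed
  have u_deriv: "((\<lambda>s. u s k) has_real_derivative dlap (\<lambda>j. Gb \<beta> (u t j)) k) (at t)" if "0 < t" for t k
  proof -
    let ?D = "\<lambda>r. dlap (\<lambda>j. Gb \<beta> (u r j)) k"
    \<comment> \<open>The base point \<open>t / 2\<close> keeps the integration away from time 0,
      where the flux may be singular.\<close>
    have "((\<lambda>x. integral {t/2..x} ?D) has_real_derivative ?D t) (at t within {t/2..t+1})"
      using that by (intro integral_has_real_derivative continuous_on_subset[OF Gu_cont]) auto
    then have "((\<lambda>x. u (t/2) k + integral {t/2..x} ?D) has_real_derivative ?D t) (at t)"
      using that at_within_Icc_at[of "t/2" t "t+1"] by (auto intro!: derivative_eq_intros)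
    then show ?thesis
    proof (rule has_field_derivative_transform_within_open)
      show "open {t/2<..}" "t \<in> {t/2<..}" using that by auto
      show "u (t/2) k + integral {t/2..x} ?D = u x k" if "x \<in> {t/2<..}" for x
        using integral_unique[OF integral_eq[of "t/2" x k]] that \<open>0 < t\<close> by simp
    qed
  qed
  have "u 0 = u0"
  proof
    fix k
    have "(\<lambda>n. U n 0 k) \<longlonglongrightarrow> u0 k + 0"
      unfolding U(2) by (intro tendsto_intros e_lim)
    then show "u 0 k = u0 k" using LIMSEQ_unique[OF u] by fastforce
  qed
  moreover have "u t \<in> linf_plus" if "0 \<le> t" for t
  proof -
    have "0 \<le> u t k" "u t k \<le> M" for k
      using u_lower[OF that, of 0] u_upper[OF that, of M] u0'(2) abs_le_D1[OF M] by auto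
    moreover from this have "norm (u t k) \<le> M" for k by simp
    ultimately show ?thesis by (auto simp: linf_plus_def bounded_iff)
  qed
  ultimately have "is_solution \<beta> u0 u"
    unfolding is_solution_def using equi u_pos u_deriv Gu_cont by auto
  then show thesis using that u_c u_lower u_upper by blast
qed

section \<open>The linear case and the heat kernel\<close>

text \<open>Integer orders make the recurrence below, and so the Laplacian in \<open>k\<close>, free
  of a special case at order 0.\<close>

definition besselI_int :: "int \<Rightarrow> real \<Rightarrow> real" where
  "besselI_int k s = (1 / pi) * integral {0..pi} (\<lambda>\<theta>. exp (s * cos \<theta>) * cos (real_of_int k * \<theta>))"

lemma besselI_int_of_nat: "besselI_int (int n) = besselI n"
  by (simp add: besselI_int_def besselI_def fun_eq_iff)

lemma besselI_int_minus: "besselI_int (- k) = besselI_int k"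
  by (simp add: besselI_int_def fun_eq_iff)

text \<open>Differentiating under the integral brings down \<open>cos \<theta>\<close>, and the
  product-to-sum formula splits it into the two neighbouring orders. Damping by exp(-2t) at argument
  2t turns this recurrence into the lattice heat equation.\<close>

lemma besselI_int_has_derivative:
  "(besselI_int k has_real_derivative (besselI_int (k - 1) s + besselI_int (k + 1) s) / 2) (at s)"
proof -
  let ?f = "\<lambda>k s \<theta>. exp (s * cos \<theta>) * cos (real_of_int k * \<theta>)"
  have int: "?f k s integrable_on {0..pi}" for k s
    by (intro integrable_continuous_real continuous_intros)
  have "((\<lambda>s. integral (cbox 0 pi) (?f k s)) has_field_derivative
      integral (cbox 0 pi) (\<lambda>\<theta>. exp (s * cos \<theta>) * cos \<theta> * cos (real_of_int k * \<theta>))) (at s within UNIV)"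
  proof (rule leibniz_rule_field_derivative[where fx = "\<lambda>s \<theta>. exp (s * cos \<theta>) * cos \<theta> * cos (real_of_int k * \<theta>)"])
    show "((\<lambda>x. ?f k x \<theta>) has_field_derivative exp (x * cos \<theta>) * cos \<theta> * cos (real_of_int k * \<theta>)) (at x within UNIV)"
      for x \<theta> by (auto intro!: derivative_eq_intros)
    show "continuous_on (UNIV \<times> cbox 0 pi) (\<lambda>(x, \<theta>). exp (x * cos \<theta>) * cos \<theta> * cos (real_of_int k * \<theta>))"
      unfolding split_beta by (intro continuous_intros)
  qed (use int in auto)
  moreover have "exp (s * cos \<theta>) * cos \<theta> * cos (real_of_int k * \<theta>) = (?f (k - 1) s \<theta> + ?f (k + 1) s \<theta>) / 2" for \<theta>
    by (simp add: algebra_simps cos_add cos_diff)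
  moreover have "integral {0..pi} (\<lambda>\<theta>. (?f (k - 1) s \<theta> + ?f (k + 1) s \<theta>) / 2) =
      (integral {0..pi} (?f (k - 1) s) + integral {0..pi} (?f (k + 1) s)) / 2"
    by (simp only: integral_divide integral_add[OF int int])
  ultimately have "((\<lambda>s. integral {0..pi} (?f k s)) has_real_derivative
      (integral {0..pi} (?f (k - 1) s) + integral {0..pi} (?f (k + 1) s)) / 2) (at s)"
    by (simp only: cbox_interval)
  from DERIV_cmult[OF this, of "1 / pi"] show ?thesis
    unfolding besselI_int_def[abs_def] by (simp add: algebra_simps add_divide_distrib)
qed

lemma besselI_int_at_0: "besselI_int k 0 = (if k = 0 then 1 else 0)"
proof (cases "k = 0")
  case False
  have "((\<lambda>\<theta>. cos (real_of_int k * \<theta>)) has_integral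
      sin (real_of_int k * pi) / k - sin (real_of_int k * 0) / k) {0..pi}"
    using False by (intro fundamental_theorem_of_calculus)
      (auto simp: has_real_derivative_iff_has_vector_derivative[symmetric] intro!: derivative_eq_intros)
  moreover have "sin (real_of_int k * pi) = 0" by (simp add: sin_zero_iff_int2)
  ultimately show ?thesis using False by (simp add: besselI_int_def integral_unique)
qed (simp add: besselI_int_def)

lemma abs_besselI_int_le: "\<bar>besselI_int k s\<bar> \<le> exp \<bar>s\<bar>"
proof -
  let ?f = "\<lambda>\<theta>. exp (s * cos \<theta>) * cos (real_of_int k * \<theta>)"
  have "norm (integral {0..pi} ?f) \<le> integral {0..pi} (\<lambda>\<theta>. exp \<bar>s\<bar>)"
  proof (rule integral_norm_bound_integral)
    show "norm (?f \<theta>) \<le> exp \<bar>s\<bar>" for \<theta>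
    proof -
      have "s * cos \<theta> \<le> \<bar>s\<bar> * \<bar>cos \<theta>\<bar>" by (metis abs_ge_self abs_mult)
      also have "\<dots> \<le> \<bar>s\<bar> * 1" by (intro mult_left_mono) auto
      finally have "exp (s * cos \<theta>) * \<bar>cos (real_of_int k * \<theta>)\<bar> \<le> exp \<bar>s\<bar> * 1"
        by (intro mult_mono) auto
      then show ?thesis by (simp add: abs_mult)
    qed
  qed (auto intro!: integrable_continuous_real continuous_intros)
  then have "\<bar>integral {0..pi} ?f\<bar> \<le> pi * exp \<bar>s\<bar>" by simp
  then show ?thesis by (simp add: besselI_int_def abs_mult field_simps)
qed

definition heat :: "real \<Rightarrow> int \<Rightarrow> real" where
  "heat t k = exp (- 2 * t) * besselI_int k (2 * t)"

lemma heat_has_derivative: "((\<lambda>t. heat t k) has_real_derivative dlap (heat t) k) (at t)"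
proof -
  have "((\<lambda>t. besselI_int k (2 * t)) has_real_derivative
      (besselI_int (k - 1) (2 * t) + besselI_int (k + 1) (2 * t)) / 2 * 2) (at t)"
    by (rule DERIV_chain2[OF besselI_int_has_derivative]) (auto intro!: derivative_eq_intros)
  then show ?thesis
    unfolding heat_def[abs_def] dlap_def
    by (auto intro!: derivative_eq_intros simp: algebra_simps)
qed

lemma heat_continuous: "continuous_on S (\<lambda>t. heat t k)"
  using heat_has_derivative by (intro continuous_at_imp_continuous_on ballI DERIV_isCont) blast

lemma abs_heat_le:
  assumes "0 \<le> t" shows "\<bar>heat t k\<bar> \<le> 1"
proof -
  have "exp (- 2 * t) * \<bar>besselI_int k (2 * t)\<bar> \<le> exp (- 2 * t) * exp (2 * t)"
    using abs_besselI_int_le[of k "2 * t"] assms by (intro mult_left_mono) auto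
  then show ?thesis by (simp add: heat_def abs_mult exp_minus)
qed

lemma heat_at_0: "heat 0 k = (if k = 0 then 1 else 0)"
  by (simp add: heat_def besselI_int_at_0)

lemma heat_minus: "heat t (- k) = heat t k"
  by (simp add: heat_def besselI_int_minus)

lemma flow_heat: "flow (\<lambda>x. x) (\<lambda>t k. d * heat t (k - l))"
  unfolding flow_def
proof (intro conjI allI impI)
  show "continuous_on {0..} (\<lambda>t. d * heat t (k - l))" for k
    by (intro continuous_intros heat_continuous)
  show "((\<lambda>t. d * heat t (k - l)) has_real_derivative dlap (\<lambda>k. d * heat t (k - l)) k) (at t)" for t k
    using DERIV_cmult[OF heat_has_derivative, of d "k - l" t]
    by (simp add: dlap_def algebra_simps)
  show "\<exists>B. \<forall>t\<in>{0..T}. \<forall>k. \<bar>d * heat t (k - l)\<bar> \<le> B" for T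
    using abs_heat_le mult_left_mono[OF abs_heat_le, of _ "\<bar>d\<bar>"]
    by (intro exI[of _ "\<bar>d\<bar> * 1"]) (auto simp: abs_mult)
qed

text \<open>For \<open>k \<noteq> 0\<close> the integrand changes sign, so the sign is taken from
  comparison with the zero solution: the initial value is a unit mass at 0.\<close>

lemma heat_nonneg:
  assumes "0 \<le> t" shows "0 \<le> heat t k"
  using flow_bounds(1)[of "\<lambda>x. x" 1 "\<lambda>t k. 1 * heat t (k - 0)" t 0 k, OF _ _ flow_heat assms]
  by (simp add: mono_def heat_at_0)

text \<open>The differences \<open>heat t n - heat t (n + 1)\<close> are odd under reflection in \<open>-1/2\<close>, so on
  \<open>n \<ge> 0\<close> they solve the heat equation with a Dirichlet condition.\<close>

lemma heat_antimono_Suc: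
  assumes "0 \<le> t" shows "heat t (int n + 1) \<le> heat t (int n)"
proof -
  define w where "w t n = heat t (int n) - heat t (int n + 1)" for t n
  define w' where "w' t n = dlap (heat t) (int n) - dlap (heat t) (int n + 1)" for t n
  have "0 \<le> w t n"
  proof (rule maximum_principle[where w = w and w' = w' and a = 0 and b = t and B = 2 and C = 2])
    show "continuous_on {0..t} (\<lambda>t. w t n)" for n
      unfolding w_def by (intro continuous_intros heat_continuous)
    show "((\<lambda>s. w s n) has_real_derivative w' s n) (at s)" for n s
      unfolding w_def w'_def by (intro DERIV_diff heat_has_derivative)
    show "- 2 \<le> w s n" if "0 \<le> s" for s n
      using abs_heat_le[OF that, of "int n"] abs_heat_le[OF that, of "int n + 1"]
      by (simp add: w_def)
    show "0 \<le> w 0 n" for n by (simp add: w_def heat_at_0)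
    show "- 2 * N \<le> w' s n" if "0 \<le> N" and N: "\<And>j. - N \<le> w s j" and neg: "w s n < 0" for N s n
    proof (cases n)
      \<comment> \<open>Reflection supplies the missing neighbour as \<open>- w s 0\<close>, which
        turns the coefficient 2 into 3; the additional term is positive where
        \<open>w s 0 < 0\<close>.\<close>
      case 0
      then have "w' s n = w s 1 - 3 * w s 0"
        using heat_minus[of s 1] by (simp add: w'_def w_def dlap_def)
      then show ?thesis using N[of 1] neg 0 \<open>0 \<le> N\<close> by simp
    next
      case (Suc m)
      then have "w' s n = w s m - 2 * w s n + w s (Suc n)"
        by (simp add: w'_def w_def dlap_def add_ac)
      then show ?thesis using N[of m] N[of "Suc n"] neg by simp
    qed
  qed (use assms in auto)
  then show ?thesis by (simp add: w_def)
qed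

lemma heat_antimono:
  assumes "0 \<le> t" "m \<le> n" shows "heat t (int n) \<le> heat t (int m)"
  using assms(2) by (induction rule: dec_induct)
    (use heat_antimono_Suc[OF assms(1)] in \<open>auto simp: add.commute intro: order_trans\<close>)

text \<open>Order 0 has a positive integrand. A higher order vanishes at 0, and its derivative is
  half the sum of the preceding order, positive by induction, and the following one, nonnegative by
  \<open>heat_nonneg\<close>. This makes the solution strictly positive for positive times.\<close>

lemma besselI_pos:
  assumes "0 < s" shows "0 < besselI n s"
  using assms
proof (induction n arbitrary: s)
  case 0
  have "pi * exp (- \<bar>s\<bar>) = integral {0..pi} (\<lambda>\<theta>. exp (- \<bar>s\<bar>))" by simp
  also have "\<dots> \<le> integral {0..pi} (\<lambda>\<theta>. exp (s * cos \<theta>))"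
  proof (rule integral_le)
    show "exp (- \<bar>s\<bar>) \<le> exp (s * cos \<theta>)" for \<theta>
      using 0 mult_left_mono[OF cos_ge_minus_one[of \<theta>], of s] by simp
  qed (auto intro!: integrable_continuous_real continuous_intros)
  finally have "0 < integral {0..pi} (\<lambda>\<theta>. exp (s * cos \<theta>))"
    by (meson exp_gt_zero less_le_trans mult_pos_pos pi_gt_zero)
  then show ?case by (simp add: besselI_def)
next
  case (Suc n)
  have D: "(besselI_int (int (Suc n)) has_real_derivative
      (besselI_int (int n) x + besselI_int (int (Suc (Suc n))) x) / 2) (at x)" for x
    using besselI_int_has_derivative[of "int (Suc n)" x] by (simp add: add_ac)
  have less: "besselI_int (int (Suc n)) 0 < besselI_int (int (Suc n)) s"
  proof (rule DERIV_pos_imp_increasing_open[OF Suc.prems])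
    show "\<exists>y. (besselI_int (int (Suc n)) has_real_derivative y) (at x) \<and> 0 < y" if x: "0 < x" for x
    proof -
      have "0 \<le> besselI_int (int (Suc (Suc n))) x"
        using heat_nonneg[of "x / 2" "int (Suc (Suc n))"] x by (simp add: heat_def zero_le_mult_iff)
      moreover have "0 < besselI_int (int n) x" using Suc.IH[OF x] by (simp add: besselI_int_of_nat)
      ultimately have "0 < (besselI_int (int n) x + besselI_int (int (Suc (Suc n))) x) / 2" by simp
      then show ?thesis using D[of x] by blast
    qed
    show "continuous_on {0..s} (besselI_int (int (Suc n)))"
      using D by (intro continuous_at_imp_continuous_on ballI DERIV_isCont) blast
  qed
  have "besselI_int (int (Suc n)) 0 = 0" by (simp add: besselI_int_at_0)
  from less[unfolded this] show ?case by (simp only: besselI_int_of_nat)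
qed

text \<open>\<open>Gb 1\<close> is the identity on nonnegative values, where the flow stays, so the
  flow itself is the solution and no limit is taken. The site used for the kernel may depend on
  \<open>k\<close>; its distance from \<open>k\<close> is at most \<open>L\<close>.\<close>

lemma linear_solution:
  assumes d: "0 < d" and u0: "u0 \<in> P_class L d"
  obtains u where "is_solution 1 u0 u"
    "\<And>t k. 0 \<le> t \<Longrightarrow> d * exp (- 2 * t) * besselI L (2 * t) \<le> u t k"
    "\<And>c t k. 0 \<le> t \<Longrightarrow> (\<And>k. c \<le> u0 k) \<Longrightarrow> c \<le> u t k"
    "\<And>c t k. 0 \<le> t \<Longrightarrow> (\<And>k. u0 k \<le> c) \<Longrightarrow> u t k \<le> c"
proof -
  have u0': "bounded (range u0)" "\<And>k. 0 \<le> u0 k"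
    using u0 by (auto simp: P_class_def linf_plus_def)
  obtain M where M: "\<And>k. \<bar>u0 k\<bar> \<le> M" using u0'(1) by (auto simp: bounded_iff)
  have mono: "mono (\<lambda>x::real. x)" by (simp add: mono_def)
  have lip: "\<bar>x - y\<bar> \<le> 1 * \<bar>x - y\<bar>" for x y :: real by simp
  obtain u where u: "flow (\<lambda>x. x) u" "u 0 = u0"
    using flow_exists[of "\<lambda>x. x" 1 u0 M] M by auto
  have lower: "c1 \<le> u t k" if "0 \<le> t" "\<And>k. c1 \<le> u0 k" for c1 t k
    by (rule flow_bounds(1)[OF mono lip u(1) that(1)]) (simp add: u(2) that)
  have upper: "u t k \<le> c2" if "0 \<le> t" "\<And>k. u0 k \<le> c2" for c2 t k
    by (rule flow_bounds(2)[OF mono lip u(1) that(1)]) (simp add: u(2) that)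
  have u_nonneg: "0 \<le> u t k" and u_le: "u t k \<le> M" if "0 \<le> t" for t k
    using lower[OF that, of 0] upper[OF that, of M] u0'(2) abs_le_D1[OF M] by auto
  have bessel: "d * exp (- 2 * t) * besselI L (2 * t) \<le> u t k" if t: "0 \<le> t" for t k
  proof -
    obtain l where l: "k < l" "l \<le> k + int L" "d \<le> u0 l" using P_class_site[OF u0] by blast
    have "heat t (int L) \<le> heat t (int (nat (l - k)))"
      using l by (intro heat_antimono t) auto
    also have "\<dots> = heat t (k - l)" using heat_minus[of t "k - l"] l by simp
    finally have "d * heat t (int L) \<le> d * heat t (k - l)" using d by simp
    also have "\<dots> \<le> u t k"
      by (rule flow_mono[OF mono lip u(1) flow_heat _ t])
        (use l u0'(2) in \<open>auto simp: heat_at_0 u(2)\<close>)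
    finally show ?thesis by (simp add: heat_def besselI_int_of_nat mult.assoc)
  qed
  have u_pos: "0 < u t k" if "0 < t" for t k
  proof (rule less_le_trans[OF _ bessel])
    show "0 < d * exp (- 2 * t) * besselI L (2 * t)" using d that by (simp add: besselI_pos)
  qed (use that in simp)
  have u_cont: "continuous_on {0..} (\<lambda>t. u t k)" for k using u by (simp add: flow_def)
  have G: "dlap (\<lambda>j. Gb 1 (u t j)) k = dlap (u t) k" if "0 \<le> t" for t k
    using u_nonneg[OF that] by (simp add: dlap_def Gb_def)
  have u_deriv: "((\<lambda>s. u s k) has_real_derivative dlap (u t) k) (at t)" if "0 < t" for t k
    using u(1) that by (simp add: flow_def)
  \<comment> \<open>Values between 0 and \<open>M\<close> have Laplacian at most
    \<open>4 * M\<close>, so the Lipschitz constant in time is the same for all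
    \<open>k\<close>.\<close>
  have lipschitz: "\<bar>u t k - u s k\<bar> \<le> 4 * M * t - 4 * M * s" if "0 \<le> s" "s \<le> t" for s t k
  proof (rule abs_diff_le_of_derivative[OF that(2), where f' = "\<lambda>t. dlap (u t) k" and h' = "\<lambda>_. 4 * M"])
    show "continuous_on {s..t} (\<lambda>t. u t k)" using u_cont by (rule continuous_on_subset) (use that in auto)
    show "\<bar>dlap (u x) k\<bar> \<le> 4 * M" if "s < x" for x
      using u_nonneg[of x] u_le[of x] that \<open>0 \<le> s\<close> by (intro abs_dlap_le) (simp add: abs_le_iff)
    show "((\<lambda>s. u s k) has_real_derivative dlap (u x) k) (at x)" if "s < x" for x
      using u_deriv that \<open>0 \<le> s\<close> by simp
  qed (auto intro!: derivative_eq_intros continuous_intros)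
  have M0: "0 \<le> M" using M[of 0] by simp
  have equi: "\<exists>\<delta>>0. \<forall>t\<ge>0. \<bar>t - t0\<bar> < \<delta> \<longrightarrow> (\<forall>k. \<bar>u t k - u t0 k\<bar> \<le> \<epsilon>)"
    if t0: "0 \<le> t0" and eps: "0 < \<epsilon>" for t0 \<epsilon>
  proof (intro exI conjI allI impI)
    show "0 < \<epsilon> / (4 * M + 1)" using M0 eps by simp
    fix t k assume t: "0 \<le> t" "\<bar>t - t0\<bar> < \<epsilon> / (4 * M + 1)"
    have "\<bar>u t k - u t0 k\<bar> \<le> 4 * M * \<bar>t - t0\<bar>"
      using lipschitz[of t0 t k] lipschitz[of t t0 k] t t0
      by (cases "t0 \<le> t") (auto simp: algebra_simps abs_minus_commute)
    also have "\<dots> \<le> (4 * M + 1) * (\<epsilon> / (4 * M + 1))"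
      using t M0 by (intro mult_mono) auto
    also have "\<dots> = \<epsilon>" using M0 by simp
    finally show "\<bar>u t k - u t0 k\<bar> \<le> \<epsilon>" .
  qed
  have Gu_cont: "continuous_on {0<..} (\<lambda>t. dlap (\<lambda>j. Gb 1 (u t j)) k)" for k
  proof (rule continuous_on_eq)
    show "continuous_on {0<..} (\<lambda>t. dlap (u t) k)"
      unfolding dlap_def by (intro continuous_intros continuous_on_subset[OF u_cont]) auto
  qed (simp add: G)
  have "u t \<in> linf_plus" if "0 \<le> t" for t
  proof -
    have "norm (u t k) \<le> M" for k using u_nonneg[OF that] u_le[OF that] by simp
    then show ?thesis using u_nonneg[OF that] by (auto simp: linf_plus_def bounded_iff)
  qed
  then have "is_solution 1 u0 u"
    unfolding is_solution_def using equi u_pos u_deriv Gu_cont u(2) by (auto simp: G)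
  then show thesis using that bessel lower upper by blast
qed

theorem theoremA3:
  fixes \<beta> d M :: real and L :: nat
  assumes "\<beta> < 0 \<or> (0 < \<beta> \<and> \<beta> \<le> 1)" and "d > 0"
  shows "\<exists>c>0. \<forall>u0. u0 \<in> P_class L d \<and> sup_norm u0 = M \<longrightarrow>
    (\<exists>u. is_solution \<beta> u0 u \<and>
      (\<beta> \<noteq> 1 \<longrightarrow> (\<forall>t\<ge>0. \<forall>k. u t k \<ge> c * min 1 (t powr (1 / (1 - \<beta>))))) \<and>
      (\<beta> = 1 \<longrightarrow> (\<forall>t\<ge>0. \<forall>k. u t k \<ge> c * exp (- 2 * t) * besselI L (2 * t))) \<and>
      (\<forall>c1 c2. (\<forall>k. c1 \<le> u0 k \<and> u0 k \<le> c2) \<longrightarrow>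
          (\<forall>t\<ge>0. \<forall>k. c1 \<le> u t k \<and> u t k \<le> c2)))"
proof (cases "\<beta> = 1")
  case True
  show ?thesis
  proof (intro exI[of _ d] conjI allI impI assms(2))
    fix u0 assume "u0 \<in> P_class L d \<and> sup_norm u0 = M"
    then obtain u where "is_solution 1 u0 u"
      "\<And>t k. 0 \<le> t \<Longrightarrow> d * exp (- 2 * t) * besselI L (2 * t) \<le> u t k"
      "\<And>c t k. 0 \<le> t \<Longrightarrow> (\<And>k. c \<le> u0 k) \<Longrightarrow> c \<le> u t k"
      "\<And>c t k. 0 \<le> t \<Longrightarrow> (\<And>k. u0 k \<le> c) \<Longrightarrow> u t k \<le> c"
      using linear_solution[OF assms(2)] by blast
    then show "\<exists>u. is_solution \<beta> u0 u \<and>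
      (\<beta> \<noteq> 1 \<longrightarrow> (\<forall>t\<ge>0. \<forall>k. u t k \<ge> d * min 1 (t powr (1 / (1 - \<beta>))))) \<and>
      (\<beta> = 1 \<longrightarrow> (\<forall>t\<ge>0. \<forall>k. u t k \<ge> d * exp (- 2 * t) * besselI L (2 * t))) \<and>
      (\<forall>c1 c2. (\<forall>k. c1 \<le> u0 k \<and> u0 k \<le> c2) \<longrightarrow>
          (\<forall>t\<ge>0. \<forall>k. c1 \<le> u t k \<and> u t k \<le> c2))"
      using True by (intro exI[of _ u]) auto
  qed
next
  case False
  then have b: "\<beta> \<noteq> 0" "\<beta> < 1" using assms(1) by auto
  show ?thesis
  proof (cases "1 \<le> L")
    case True
    obtain c where c: "0 < c"
      "\<forall>e>0. \<forall>u. flow (Gb_cut \<beta> e) u \<and> (\<forall>k. e \<le> u 0 k) \<and>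
        (\<forall>k. \<exists>l. k < l \<and> l \<le> k + int L \<and> d \<le> u 0 l) \<longrightarrow>
        (\<forall>t\<ge>0. \<forall>k. c * min 1 (t powr (1 / (1 - \<beta>))) \<le> u t k)"
      using flow_lower_bound[OF b assms(2) True] by metis
    show ?thesis
    proof (intro exI[of _ c] conjI allI impI c(1))
      fix u0 assume "u0 \<in> P_class L d \<and> sup_norm u0 = M"
      then have u0: "u0 \<in> P_class L d" by simp
      obtain u where "is_solution \<beta> u0 u"
        "\<And>t k. 0 \<le> t \<Longrightarrow> c * min 1 (t powr (1 / (1 - \<beta>))) \<le> u t k"
        "\<And>c t k. 0 \<le> t \<Longrightarrow> (\<And>k. c \<le> u0 k) \<Longrightarrow> c \<le> u t k"
        "\<And>c t k. 0 \<le> t \<Longrightarrow> (\<And>k. u0 k \<le> c) \<Longrightarrow> u t k \<le> c"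
        by (rule nonlinear_solution[OF b c u0]) blast+
      then show "\<exists>u. is_solution \<beta> u0 u \<and>
        (\<beta> \<noteq> 1 \<longrightarrow> (\<forall>t\<ge>0. \<forall>k. u t k \<ge> c * min 1 (t powr (1 / (1 - \<beta>))))) \<and>
        (\<beta> = 1 \<longrightarrow> (\<forall>t\<ge>0. \<forall>k. u t k \<ge> c * exp (- 2 * t) * besselI L (2 * t))) \<and>
        (\<forall>c1 c2. (\<forall>k. c1 \<le> u0 k \<and> u0 k \<le> c2) \<longrightarrow>
            (\<forall>t\<ge>0. \<forall>k. c1 \<le> u t k \<and> u t k \<le> c2))"
        using False by (intro exI[of _ u]) auto
    qed
  next
    case False
    \<comment> \<open>With \<open>L = 0\<close> the window from \<open>k + 1\<close> to
      \<open>k + L\<close> is empty, hence so is the class, and any positive constant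
      serves.\<close>
    then have "u0 \<notin> P_class L d" for u0 using P_class_site[of u0 L d 0] by auto
    then show ?thesis by (intro exI[of _ 1]) simp
  qed
qed

end
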